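(* Let $(R,P_\Omega)$ be a multiple Rota-Baxter algebra of pair weight $(\lambda_\Omega,\lambda_\Omega)$ and let $(M,\mathfrak{m}_\Omega)$ be a left $(R,P_\Omega)$-module. Then $(M,\mathfrak{m}_\Omega)$ can be embedded into an injective left $(R,P_\Omega)$-module, i.e. there is an injective left $(R,P_\Omega)$-module $(T,\mathfrak{t}_\Omega)$ and a left $(R,P_\Omega)$-module monomorphism $(M,\mathfrak{m}_\Omega)\to(T,\mathfrak{t}_\Omega)$.
   Context: $\mathbf{k}$ is a commutative unital ring; algebras are associative unital $\mathbf{k}$-algebras, modules are unital, "linear" means $\mathbf{k}$-linear. $\Omega$ is a nonempty set and $\lambda_\Omega=(\lambda_\omega)_{\omega\in\Omega}$ a family of elements of $\mathbf{k}$. A multiple Rota-Baxter algebra $(R,P_\Omega)$ of pair weight $(\lambda_\Omega,\lambda_\Omega)$ is an algebra $R$ with linear operators $P_\omega:R\to R$ ($\omega\in\Omega$) such that $P_\alpha(r)P_\beta(s)=P_\alpha(rP_\beta(s))+P_\beta(P_\alpha(r)s)+\lambda_\beta P_\alpha(rs)+\lambda_\alpha P_\beta(rs)$ for all $r,s\in R$, $\alpha,\beta\in\Omega$. A left $(R,P_\Omega)$-module $(M,\mathfrak{m}_\Omega)$ is a left $R$-module $M$ with linear operators $\mathfrak{m}_\omega:M\to M$ ($\omega\in\Omega$) such that $P_\alpha(r)\mathfrak{m}_\beta(m)=\mathfrak{m}_\alpha(r\mathfrak{m}_\beta(m))+\mathfrak{m}_\beta(P_\alpha(r)m)+\lambda_\beta\mathfrak{m}_\alpha(rm)+\lambda_\alpha\mathfrak{m}_\beta(rm)$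 for all $r\in R,m\in M,\alpha,\beta\in\Omega$. A homomorphism of left $(R,P_\Omega)$-modules is a left $R$-module homomorphism $\phi:(M,\mathfrak{m}_\Omega)\to(N,\mathfrak{n}_\Omega)$ with $\phi\circ\mathfrak{m}_\omega=\mathfrak{n}_\omega\circ\phi$ for all $\omega$; monomorphism means injective homomorphism. A left $(R,P_\Omega)$-module $(T,\mathfrak{t}_\Omega)$ is injective if for every left $(R,P_\Omega)$-module monomorphism $\theta:(M,\mathfrak{m}_\Omega)\to(N,\mathfrak{n}_\Omega)$ and every left $(R,P_\Omega)$-module homomorphism $\varphi:(M,\mathfrak{m}_\Omega)\to(T,\mathfrak{t}_\Omega)$ there is a left $(R,P_\Omega)$-module homomorphism $\overline\varphi:(N,\mathfrak{n}_\Omega)\to(T,\mathfrak{t}_\Omega)$ with $\varphi=\overline\varphi\circ\theta$. *)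

theory Defs
  imports Complex_Main "HOL-Algebra.Module"
begin

section \<open>Algebras, left modules, linear operators\<close>

text \<open>The library locales \<open>algebra\<close> and \<open>module\<close> assume, respectively, that the algebra and the
  ring of scalars are commutative; neither is wanted here for the algebra \<open>R\<close>.  As in the library,
  a ring may be the zero ring.\<close>

locale assoc_algebra = module K R + ring R for K and R (structure) +
  assumes smult_mult_left:
      "\<lbrakk>c \<in> carrier K; x \<in> carrier R; y \<in> carrier R\<rbrakk> \<Longrightarrow> (c \<odot> x) \<otimes> y = c \<odot> (x \<otimes> y)"
    and smult_mult_right:
      "\<lbrakk>c \<in> carrier K; x \<in> carrier R; y \<in> carrier R\<rbrakk> \<Longrightarrow> x \<otimes> (c \<odot> y) = c \<odot> (x \<otimes> y)"

text \<open>The record type \<open>module\<close> extends \<open>ring\<close>; the fields \<open>mult\<close> and \<open>one\<close> of \<open>M\<close> are not used.\<close>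

locale left_module = R?: ring R + M?: abelian_group M for R (structure) and M (structure) +
  assumes act_closed:
      "\<lbrakk>a \<in> carrier R; x \<in> carrier M\<rbrakk> \<Longrightarrow> a \<odot>\<^bsub>M\<^esub> x \<in> carrier M"
    and act_l_distr:
      "\<lbrakk>a \<in> carrier R; b \<in> carrier R; x \<in> carrier M\<rbrakk> \<Longrightarrow>
        (a \<oplus> b) \<odot>\<^bsub>M\<^esub> x = a \<odot>\<^bsub>M\<^esub> x \<oplus>\<^bsub>M\<^esub> b \<odot>\<^bsub>M\<^esub> x"
    and act_r_distr:
      "\<lbrakk>a \<in> carrier R; x \<in> carrier M; y \<in> carrier M\<rbrakk> \<Longrightarrow>
        a \<odot>\<^bsub>M\<^esub> (x \<oplus>\<^bsub>M\<^esub> y) = a \<odot>\<^bsub>M\<^esub> x \<oplus>\<^bsub>M\<^esub> a \<odot>\<^bsub>M\<^esub> y"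
    and act_assoc:
      "\<lbrakk>a \<in> carrier R; b \<in> carrier R; x \<in> carrier M\<rbrakk> \<Longrightarrow>
        (a \<otimes> b) \<odot>\<^bsub>M\<^esub> x = a \<odot>\<^bsub>M\<^esub> (b \<odot>\<^bsub>M\<^esub> x)"
    and act_one:
      "x \<in> carrier M \<Longrightarrow> \<one> \<odot>\<^bsub>M\<^esub> x = x"

text \<open>A left module over a \<open>K\<close>-algebra \<open>R\<close> is a \<open>K\<close>-module through \<open>K \<rightarrow> R\<close>, \<open>c \<mapsto> c 1\<close>.\<close>

definition restrict_scalars :: "('k, 'r) module \<Rightarrow> ('r, 'm) module \<Rightarrow> ('k, 'm) module" where
  "restrict_scalars R M =
     \<lparr>carrier = carrier M, mult = mult M, one = one M, zero = zero M, add = add M,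
      smult = (\<lambda>c x. (c \<odot>\<^bsub>R\<^esub> \<one>\<^bsub>R\<^esub>) \<odot>\<^bsub>M\<^esub> x)\<rparr>"

definition linear_operator :: "'k ring \<Rightarrow> ('k, 'v) module \<Rightarrow> ('v \<Rightarrow> 'v) \<Rightarrow> bool" where
  "linear_operator K V f \<longleftrightarrow>
     f \<in> carrier V \<rightarrow> carrier V \<and>
     (\<forall>x\<in>carrier V. \<forall>y\<in>carrier V. f (x \<oplus>\<^bsub>V\<^esub> y) = f x \<oplus>\<^bsub>V\<^esub> f y) \<and>
     (\<forall>c\<in>carrier K. \<forall>x\<in>carrier V. f (c \<odot>\<^bsub>V\<^esub> x) = c \<odot>\<^bsub>V\<^esub> f x)"


section \<open>Multiple Rota-Baxter algebras and their left modules\<close>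

definition mrb_algebra ::
    "'k ring \<Rightarrow> 'w set \<Rightarrow> ('w \<Rightarrow> 'k) \<Rightarrow> ('k, 'r) module \<Rightarrow> ('w \<Rightarrow> 'r \<Rightarrow> 'r) \<Rightarrow> bool" where
  "mrb_algebra K \<Omega> \<Lambda> R P \<longleftrightarrow>
     assoc_algebra K R \<and> \<Omega> \<noteq> {} \<and> \<Lambda> \<in> \<Omega> \<rightarrow> carrier K \<and>
     (\<forall>\<omega>\<in>\<Omega>. linear_operator K R (P \<omega>)) \<and>
     (\<forall>\<alpha>\<in>\<Omega>. \<forall>\<beta>\<in>\<Omega>. \<forall>r\<in>carrier R. \<forall>s\<in>carrier R.
        P \<alpha> r \<otimes>\<^bsub>R\<^esub> P \<beta> s =
          P \<alpha> (r \<otimes>\<^bsub>R\<^esub> P \<beta> s) \<oplus>\<^bsub>R\<^esub> P \<beta> (P \<alpha> r \<otimes>\<^bsub>R\<^esub> s)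
            \<oplus>\<^bsub>R\<^esub> \<Lambda> \<beta> \<odot>\<^bsub>R\<^esub> P \<alpha> (r \<otimes>\<^bsub>R\<^esub> s) \<oplus>\<^bsub>R\<^esub> \<Lambda> \<alpha> \<odot>\<^bsub>R\<^esub> P \<beta> (r \<otimes>\<^bsub>R\<^esub> s))"

definition mrb_module ::
    "'k ring \<Rightarrow> 'w set \<Rightarrow> ('w \<Rightarrow> 'k) \<Rightarrow> ('k, 'r) module \<Rightarrow> ('w \<Rightarrow> 'r \<Rightarrow> 'r) \<Rightarrow>
      ('r, 'm) module \<Rightarrow> ('w \<Rightarrow> 'm \<Rightarrow> 'm) \<Rightarrow> bool" where
  "mrb_module K \<Omega> \<Lambda> R P M m \<longleftrightarrow>
     left_module R M \<and>
     (\<forall>\<omega>\<in>\<Omega>. linear_operator K (restrict_scalars R M) (m \<omega>)) \<and>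
     (\<forall>\<alpha>\<in>\<Omega>. \<forall>\<beta>\<in>\<Omega>. \<forall>r\<in>carrier R. \<forall>x\<in>carrier M.
        P \<alpha> r \<odot>\<^bsub>M\<^esub> m \<beta> x =
          m \<alpha> (r \<odot>\<^bsub>M\<^esub> m \<beta> x) \<oplus>\<^bsub>M\<^esub> m \<beta> (P \<alpha> r \<odot>\<^bsub>M\<^esub> x)
            \<oplus>\<^bsub>M\<^esub> \<Lambda> \<beta> \<odot>\<^bsub>restrict_scalars R M\<^esub> m \<alpha> (r \<odot>\<^bsub>M\<^esub> x)
            \<oplus>\<^bsub>M\<^esub> \<Lambda> \<alpha> \<odot>\<^bsub>restrict_scalars R M\<^esub> m \<beta> (r \<odot>\<^bsub>M\<^esub> x))"

definition mrb_hom ::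
    "'w set \<Rightarrow> ('k, 'r) module \<Rightarrow> ('r, 'm) module \<Rightarrow> ('w \<Rightarrow> 'm \<Rightarrow> 'm) \<Rightarrow>
      ('r, 'n) module \<Rightarrow> ('w \<Rightarrow> 'n \<Rightarrow> 'n) \<Rightarrow> ('m \<Rightarrow> 'n) set" where
  "mrb_hom \<Omega> R M m N n =
     {\<phi>. \<phi> \<in> carrier M \<rightarrow> carrier N \<and>
        (\<forall>x\<in>carrier M. \<forall>y\<in>carrier M. \<phi> (x \<oplus>\<^bsub>M\<^esub> y) = \<phi> x \<oplus>\<^bsub>N\<^esub> \<phi> y) \<and>
        (\<forall>r\<in>carrier R. \<forall>x\<in>carrier M. \<phi> (r \<odot>\<^bsub>M\<^esub> x) = r \<odot>\<^bsub>N\<^esub> \<phi> x) \<and>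
        (\<forall>\<omega>\<in>\<Omega>. \<forall>x\<in>carrier M. \<phi> (m \<omega> x) = n \<omega> (\<phi> x))}"

definition mrb_mono ::
    "'w set \<Rightarrow> ('k, 'r) module \<Rightarrow> ('r, 'm) module \<Rightarrow> ('w \<Rightarrow> 'm \<Rightarrow> 'm) \<Rightarrow>
      ('r, 'n) module \<Rightarrow> ('w \<Rightarrow> 'n \<Rightarrow> 'n) \<Rightarrow> ('m \<Rightarrow> 'n) set" where
  "mrb_mono \<Omega> R M m N n = {\<phi> \<in> mrb_hom \<Omega> R M m N n. inj_on \<phi> (carrier M)}"

text \<open>A formula of HOL cannot quantify over types, so the types \<open>'a\<close> and \<open>'b\<close> of the elements of the
  test modules \<open>M\<close> and \<open>N\<close> are parameters.\<close>

definition mrb_injective ::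
    "'a itself \<Rightarrow> 'b itself \<Rightarrow> 'k ring \<Rightarrow> 'w set \<Rightarrow> ('w \<Rightarrow> 'k) \<Rightarrow> ('k, 'r) module \<Rightarrow>
      ('w \<Rightarrow> 'r \<Rightarrow> 'r) \<Rightarrow> ('r, 't) module \<Rightarrow> ('w \<Rightarrow> 't \<Rightarrow> 't) \<Rightarrow> bool" where
  "mrb_injective A B K \<Omega> \<Lambda> R P T t \<longleftrightarrow>
     mrb_module K \<Omega> \<Lambda> R P T t \<and>
     (\<forall>(M :: ('r, 'a) module) m (N :: ('r, 'b) module) n \<theta> \<phi>.
        mrb_module K \<Omega> \<Lambda> R P M m \<longrightarrow> mrb_module K \<Omega> \<Lambda> R P N n \<longrightarrow>
        \<theta> \<in> mrb_mono \<Omega> R M m N n \<longrightarrow> \<phi> \<in> mrb_hom \<Omega> R M m T t \<longrightarrow>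
        (\<exists>\<psi>\<in>mrb_hom \<Omega> R N n T t. \<forall>x\<in>carrier M. \<phi> x = \<psi> (\<theta> x)))"


section \<open>Injectivity does not depend on the types of the test modules\<close>

text \<open>Every element of the submodule generated by \<open>x\<close> is the value at \<open>x\<close> of one of the following
  terms.  Hence every cyclic module has a copy whose elements are terms, and Baer's argument shows
  (\<open>mrb_injective_all_types\<close>) that a module that is injective with respect to
  test modules whose elements are terms is injective with respect to test modules of any types.
  An existence claim for a module that is injective with respect to term modules therefore yields one
  module that is injective with respect to all modules.\<close>

datatype ('r, 'w) mrb_term =
  Gen | Add "('r, 'w) mrb_term" "('r, 'w) mrb_term" | Act 'r "('r, 'w) mrb_term"
  | Op 'w "('r, 'w) mrb_term"

primrec term_wf :: "'w set \<Rightarrow> ('k, 'r) module \<Rightarrow> ('r, 'w) mrb_term \<Rightarrow> bool" where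
  "term_wf \<Omega> R Gen \<longleftrightarrow> True"
| "term_wf \<Omega> R (Add e f) \<longleftrightarrow> term_wf \<Omega> R e \<and> term_wf \<Omega> R f"
| "term_wf \<Omega> R (Act r e) \<longleftrightarrow> r \<in> carrier R \<and> term_wf \<Omega> R e"
| "term_wf \<Omega> R (Op w e) \<longleftrightarrow> w \<in> \<Omega> \<and> term_wf \<Omega> R e"

primrec term_val :: "('r, 'm) module \<Rightarrow> ('w \<Rightarrow> 'm \<Rightarrow> 'm) \<Rightarrow> 'm \<Rightarrow> ('r, 'w) mrb_term \<Rightarrow> 'm" where
  "term_val M m x Gen = x"
| "term_val M m x (Add e f) = term_val M m x e \<oplus>\<^bsub>M\<^esub> term_val M m x f"
| "term_val M m x (Act r e) = r \<odot>\<^bsub>M\<^esub> term_val M m x e"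
| "term_val M m x (Op w e) = m w (term_val M m x e)"

definition mrb_closed ::
    "'w set \<Rightarrow> ('k, 'r) module \<Rightarrow> ('r, 'm) module \<Rightarrow> ('w \<Rightarrow> 'm \<Rightarrow> 'm) \<Rightarrow> 'm set \<Rightarrow> bool" where
  "mrb_closed \<Omega> R M m S \<longleftrightarrow> S \<subseteq> carrier M \<and> \<zero>\<^bsub>M\<^esub> \<in> S \<and>
     (\<forall>x\<in>S. \<forall>y\<in>S. x \<oplus>\<^bsub>M\<^esub> y \<in> S) \<and> (\<forall>r\<in>carrier R. \<forall>x\<in>S. r \<odot>\<^bsub>M\<^esub> x \<in> S) \<and>
     (\<forall>\<omega>\<in>\<Omega>. \<forall>x\<in>S. m \<omega> x \<in> S)"

definition transport ::
    "('m \<Rightarrow> 'c) \<Rightarrow> ('c \<Rightarrow> 'm) \<Rightarrow> 'm set \<Rightarrow> ('r, 'm) module \<Rightarrow> ('r, 'c) module" where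
  "transport f g S M =
     \<lparr>carrier = f ` S, mult = undefined, one = undefined, zero = f \<zero>\<^bsub>M\<^esub>,
      add = (\<lambda>a b. f (g a \<oplus>\<^bsub>M\<^esub> g b)), smult = (\<lambda>r a. f (r \<odot>\<^bsub>M\<^esub> g a))\<rparr>"

context left_module
begin

lemma act_zero_left: "x \<in> carrier M \<Longrightarrow> \<zero> \<odot>\<^bsub>M\<^esub> x = \<zero>\<^bsub>M\<^esub>"
  using act_l_distr[of \<zero> \<zero> x] act_closed[of \<zero> x] by (metis M.add.r_cancel_one' R.zero_closed R.l_zero)

lemma act_minus_one: "x \<in> carrier M \<Longrightarrow> (\<ominus> \<one>) \<odot>\<^bsub>M\<^esub> x = \<ominus>\<^bsub>M\<^esub> x"
proof -
  assume x: "x \<in> carrier M"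
  have "(\<ominus> \<one>) \<odot>\<^bsub>M\<^esub> x \<oplus>\<^bsub>M\<^esub> x = (\<ominus> \<one> \<oplus> \<one>) \<odot>\<^bsub>M\<^esub> x"
    using x by (simp add: act_l_distr act_one)
  also have "\<dots> = \<zero>\<^bsub>M\<^esub>" using x by (simp add: act_zero_left R.l_neg)
  finally show ?thesis
    using x act_closed[of "\<ominus> \<one>" x] by (simp add: M.minus_equality)
qed

end

lemma mrb_module_transport:
  assumes N: "mrb_module K \<Omega> \<Lambda> R P N n"
    and S: "mrb_closed \<Omega> R N n S"
    and gf: "\<And>x. x \<in> S \<Longrightarrow> g (f x) = x"
    and alg: "mrb_algebra K \<Omega> \<Lambda> R P"
  shows "mrb_module K \<Omega> \<Lambda> R P (transport f g S N) (\<lambda>\<omega> a. f (n \<omega> (g a)))"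
proof -
  interpret N: left_module R N using N by (simp add: mrb_module_def)
  have sub: "\<And>x. x \<in> S \<Longrightarrow> x \<in> carrier N" and z: "\<zero>\<^bsub>N\<^esub> \<in> S"
    and ad: "\<And>x y. x \<in> S \<Longrightarrow> y \<in> S \<Longrightarrow> x \<oplus>\<^bsub>N\<^esub> y \<in> S"
    and sm: "\<And>r x. r \<in> carrier R \<Longrightarrow> x \<in> S \<Longrightarrow> r \<odot>\<^bsub>N\<^esub> x \<in> S"
    and op: "\<And>\<omega> x. \<omega> \<in> \<Omega> \<Longrightarrow> x \<in> S \<Longrightarrow> n \<omega> x \<in> S"
    using S by (auto simp: mrb_closed_def)
  interpret A: assoc_algebra K R using alg by (simp add: mrb_algebra_def)
  have K1: "\<And>c. c \<in> carrier K \<Longrightarrow> c \<odot>\<^bsub>R\<^esub> \<one>\<^bsub>R\<^esub> \<in> carrier R" by simp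
  have lam: "\<And>\<omega>. \<omega> \<in> \<Omega> \<Longrightarrow> \<Lambda> \<omega> \<in> carrier K" using alg by (auto simp: mrb_algebra_def)
  have PR: "\<And>\<omega> r. \<omega> \<in> \<Omega> \<Longrightarrow> r \<in> carrier R \<Longrightarrow> P \<omega> r \<in> carrier R"
    using alg by (auto simp: mrb_algebra_def linear_operator_def)
  let ?T = "transport f g S N"
  have ag: "abelian_group ?T"
  proof (rule abelian_groupI, goal_cases)
    case (6 x)
    then obtain y where y: "y \<in> S" "x = f y" by (auto simp: transport_def)
    have "(\<ominus>\<^bsub>R\<^esub> \<one>\<^bsub>R\<^esub>) \<odot>\<^bsub>N\<^esub> y \<in> S" using y sm by simp
    then have "\<ominus>\<^bsub>N\<^esub> y \<in> S" using y sub by (simp add: N.act_minus_one)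
    then show ?case using y gf sub
      by (intro bexI[of _ "f (\<ominus>\<^bsub>N\<^esub> y)"]) (auto simp: transport_def N.M.l_neg)
  qed (auto simp: transport_def gf z ad sub N.M.a_ac)
  have lm: "left_module R ?T"
    by (intro left_module.intro left_module_axioms.intro ag N.R.ring_axioms)
      (auto simp: transport_def gf z ad sm sub N.act_closed N.act_l_distr N.act_r_distr
        N.act_assoc N.act_one)
  have lin: "linear_operator K (restrict_scalars R ?T) (\<lambda>a. f (n \<omega> (g a)))" if w: "\<omega> \<in> \<Omega>" for \<omega>
  proof -
    have "linear_operator K (restrict_scalars R N) (n \<omega>)" using N w by (simp add: mrb_module_def)
    then show ?thesis using w
      by (auto simp: linear_operator_def restrict_scalars_def transport_def gf z ad sm sub op K1)
  qed
  show ?thesis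
    unfolding mrb_module_def
  proof (intro conjI ballI lm lin, assumption)
    fix \<alpha> \<beta> r x assume h: "\<alpha> \<in> \<Omega>" "\<beta> \<in> \<Omega>" "r \<in> carrier R" "x \<in> carrier ?T"
    then obtain y where y: "y \<in> S" "x = f y" by (auto simp: transport_def)
    have "P \<alpha> r \<odot>\<^bsub>N\<^esub> n \<beta> y =
          n \<alpha> (r \<odot>\<^bsub>N\<^esub> n \<beta> y) \<oplus>\<^bsub>N\<^esub> n \<beta> (P \<alpha> r \<odot>\<^bsub>N\<^esub> y)
            \<oplus>\<^bsub>N\<^esub> \<Lambda> \<beta> \<odot>\<^bsub>restrict_scalars R N\<^esub> n \<alpha> (r \<odot>\<^bsub>N\<^esub> y)
            \<oplus>\<^bsub>N\<^esub> \<Lambda> \<alpha> \<odot>\<^bsub>restrict_scalars R N\<^esub> n \<beta> (r \<odot>\<^bsub>N\<^esub> y)"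
      using N h y sub unfolding mrb_module_def by blast
    then show "P \<alpha> r \<odot>\<^bsub>?T\<^esub> f (n \<beta> (g x)) =
          f (n \<alpha> (g (r \<odot>\<^bsub>?T\<^esub> f (n \<beta> (g x))))) \<oplus>\<^bsub>?T\<^esub> f (n \<beta> (g (P \<alpha> r \<odot>\<^bsub>?T\<^esub> x)))
            \<oplus>\<^bsub>?T\<^esub> \<Lambda> \<beta> \<odot>\<^bsub>restrict_scalars R ?T\<^esub> f (n \<alpha> (g (r \<odot>\<^bsub>?T\<^esub> x)))
            \<oplus>\<^bsub>?T\<^esub> \<Lambda> \<alpha> \<odot>\<^bsub>restrict_scalars R ?T\<^esub> f (n \<beta> (g (r \<odot>\<^bsub>?T\<^esub> x)))"
      using h y by (simp add: transport_def restrict_scalars_def gf ad sm op PR lam K1)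
  qed
qed

lemma mrb_injective_all_types:
  fixes K :: "'k ring" and R :: "('k, 'r) module" and P :: "'w \<Rightarrow> 'r \<Rightarrow> 'r"
    and T :: "('r, 't) module"
  assumes alg: "mrb_algebra K \<Omega> \<Lambda> R P"
    and inj: "mrb_injective TYPE(('r, 'w) mrb_term) TYPE(('r, 'w) mrb_term) K \<Omega> \<Lambda> R P T t"
  shows "mrb_injective TYPE('a) TYPE('b) K \<Omega> \<Lambda> R P T t"
proof -
  have T: "mrb_module K \<Omega> \<Lambda> R P T t" using inj by (simp add: mrb_injective_def)
  interpret T: left_module R T using T by (simp add: mrb_module_def)
  have top: "\<And>\<omega> x. \<omega> \<in> \<Omega> \<Longrightarrow> x \<in> carrier T \<Longrightarrow> t \<omega> x \<in> carrier T"
    and topa: "\<And>\<omega> x y. \<omega> \<in> \<Omega> \<Longrightarrow> x \<in> carrier T \<Longrightarrow> y \<in> carrier T \<Longrightarrow>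
        t \<omega> (x \<oplus>\<^bsub>T\<^esub> y) = t \<omega> x \<oplus>\<^bsub>T\<^esub> t \<omega> y"
    using T by (auto simp: mrb_module_def linear_operator_def restrict_scalars_def)
  have "\<exists>\<psi>\<in>mrb_hom \<Omega> R N n T t. \<forall>x\<in>carrier M. \<phi> x = \<psi> (\<theta> x)"
    if M: "mrb_module K \<Omega> \<Lambda> R P M m" and N: "mrb_module K \<Omega> \<Lambda> R P N n"
      and th: "\<theta> \<in> mrb_mono \<Omega> R M m N n" and ph: "\<phi> \<in> mrb_hom \<Omega> R M m T t"
    for M :: "('r, 'a) module" and m and N :: "('r, 'b) module" and n \<theta> \<phi>
  proof -
    interpret M: left_module R M using M by (simp add: mrb_module_def)
    interpret N: left_module R N using N by (simp add: mrb_module_def)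
    have nop: "\<And>\<omega> x. \<omega> \<in> \<Omega> \<Longrightarrow> x \<in> carrier N \<Longrightarrow> n \<omega> x \<in> carrier N"
      and nopa: "\<And>\<omega> x y. \<omega> \<in> \<Omega> \<Longrightarrow> x \<in> carrier N \<Longrightarrow> y \<in> carrier N \<Longrightarrow>
        n \<omega> (x \<oplus>\<^bsub>N\<^esub> y) = n \<omega> x \<oplus>\<^bsub>N\<^esub> n \<omega> y"
      using N by (auto simp: mrb_module_def linear_operator_def restrict_scalars_def)
    have mop: "\<And>\<omega> x. \<omega> \<in> \<Omega> \<Longrightarrow> x \<in> carrier M \<Longrightarrow> m \<omega> x \<in> carrier M"
      using M by (auto simp: mrb_module_def linear_operator_def restrict_scalars_def)
    define graph where "graph G \<longleftrightarrow> G \<subseteq> carrier N \<times> carrier T \<and>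
        (\<forall>x\<in>carrier M. (\<theta> x, \<phi> x) \<in> G) \<and>
        (\<forall>a b c d. (a, b) \<in> G \<longrightarrow> (c, d) \<in> G \<longrightarrow> (a \<oplus>\<^bsub>N\<^esub> c, b \<oplus>\<^bsub>T\<^esub> d) \<in> G) \<and>
        (\<forall>r\<in>carrier R. \<forall>a b. (a, b) \<in> G \<longrightarrow> (r \<odot>\<^bsub>N\<^esub> a, r \<odot>\<^bsub>T\<^esub> b) \<in> G) \<and>
        (\<forall>\<omega>\<in>\<Omega>. \<forall>a b. (a, b) \<in> G \<longrightarrow> (n \<omega> a, t \<omega> b) \<in> G) \<and>
        (\<forall>a b c. (a, b) \<in> G \<longrightarrow> (a, c) \<in> G \<longrightarrow> b = c)" for G
    have grsub: "a \<in> carrier N \<and> b \<in> carrier T" if "graph G" "(a, b) \<in> G" for G a b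
      using that(1)[unfolded graph_def, THEN conjunct1] that(2) by auto
    have grth: "(\<theta> x, \<phi> x) \<in> G" if "graph G" "x \<in> carrier M" for G x
      using that(1)[unfolded graph_def, THEN conjunct2, THEN conjunct1] that(2) by (rule bspec)
    have grad: "(a \<oplus>\<^bsub>N\<^esub> c, b \<oplus>\<^bsub>T\<^esub> d) \<in> G" if "graph G" "(a, b) \<in> G" "(c, d) \<in> G" for G a b c d
      using that(1)[unfolded graph_def, THEN conjunct2, THEN conjunct2, THEN conjunct1] that(2,3)
      by simp
    have grsm: "(r \<odot>\<^bsub>N\<^esub> a, r \<odot>\<^bsub>T\<^esub> b) \<in> G"
      if "graph G" "r \<in> carrier R" "(a, b) \<in> G" for G r a b
      using that(1)[unfolded graph_def, THEN conjunct2, THEN conjunct2, THEN conjunct2,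
          THEN conjunct1] that(2,3) by simp
    have grop: "(n \<omega> a, t \<omega> b) \<in> G" if "graph G" "\<omega> \<in> \<Omega>" "(a, b) \<in> G" for G \<omega> a b
      using that(1)[unfolded graph_def, THEN conjunct2, THEN conjunct2, THEN conjunct2,
          THEN conjunct2, THEN conjunct1] that(2,3) by simp
    have grsv: "b = c" if "graph G" "(a, b) \<in> G" "(a, c) \<in> G" for G a b c
      using that(1)[unfolded graph_def, THEN conjunct2, THEN conjunct2, THEN conjunct2,
          THEN conjunct2, THEN conjunct2] that(2,3) by (meson)
    have g0: "graph ((\<lambda>x. (\<theta> x, \<phi> x)) ` carrier M)"
    proof -
      have "inj_on \<theta> (carrier M)" using th by (simp add: mrb_mono_def)
      moreover have "\<theta> \<in> mrb_hom \<Omega> R M m N n" using th by (simp add: mrb_mono_def)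
      ultimately show ?thesis using ph
        unfolding graph_def mrb_hom_def
        apply (intro conjI)
        subgoal by auto
        subgoal by auto
        subgoal by clarsimp (metis (mono_tags, lifting) M.M.add.m_closed image_eqI)
        subgoal by clarsimp (metis (mono_tags, lifting) M.act_closed image_eqI)
        subgoal by clarsimp (metis (mono_tags, lifting) mop image_eqI)
        subgoal by (auto dest: inj_onD)
        done
    qed
    have "\<exists>G\<in>{G. graph G}. \<forall>X\<in>{G. graph G}. G \<subseteq> X \<longrightarrow> X = G"
    proof (rule subset_Zorn_nonempty)
      show "{G. graph G} \<noteq> {}" using g0 by blast
      fix C assume ne: "C \<noteq> {}" and ch: "subset.chain {G. graph G} C"
      have gC: "\<And>G. G \<in> C \<Longrightarrow> graph G" using ch by (auto simp: subset.chain_def)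
      have two: "\<exists>G\<in>C. p \<in> G \<and> q \<in> G" if pq: "p \<in> \<Union>C" "q \<in> \<Union>C" for p q
      proof -
        obtain G H where "G \<in> C" "p \<in> G" "H \<in> C" "q \<in> H" using pq by blast
        moreover have "G \<subseteq> H \<or> H \<subseteq> G" using ch calculation by (auto simp: subset_chain_def)
        ultimately show ?thesis by blast
      qed
      have "graph (\<Union>C)"
        unfolding graph_def
      proof (intro conjI allI ballI impI)
        show "\<Union>C \<subseteq> carrier N \<times> carrier T" using grsub[OF gC] by auto
        show "(\<theta> x, \<phi> x) \<in> \<Union>C" if "x \<in> carrier M" for x
          using ne grth[OF gC that] by blast
        show "(a \<oplus>\<^bsub>N\<^esub> c, b \<oplus>\<^bsub>T\<^esub> d) \<in> \<Union>C" if "(a, b) \<in> \<Union>C" "(c, d) \<in> \<Union>C" for a b c d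
          using two[OF that] grad[OF gC] by blast
        show "(r \<odot>\<^bsub>N\<^esub> a, r \<odot>\<^bsub>T\<^esub> b) \<in> \<Union>C" if "r \<in> carrier R" "(a, b) \<in> \<Union>C" for r a b
          using that grsm[OF gC] by blast
        show "(n \<omega> a, t \<omega> b) \<in> \<Union>C" if "\<omega> \<in> \<Omega>" "(a, b) \<in> \<Union>C" for \<omega> a b
          using that grop[OF gC] by blast
        show "b = c" if "(a, b) \<in> \<Union>C" "(a, c) \<in> \<Union>C" for a b c
          using two[OF that] grsv[OF gC] by blast
      qed
      then show "\<Union>C \<in> {G. graph G}" by simp
    qed
    then obtain G where G: "graph G" and max: "\<And>X. graph X \<Longrightarrow> G \<subseteq> X \<Longrightarrow> X = G" by blast
    note Gsub = grsub[OF G] and Gth = grth[OF G] and Gad = grad[OF G] and Gsm = grsm[OF G]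
      and Gop = grop[OF G] and Gsv = grsv[OF G]
    have G0: "(\<zero>\<^bsub>N\<^esub>, \<zero>\<^bsub>T\<^esub>) \<in> G"
      using Gsm[OF _ Gth[OF M.M.zero_closed], of "\<zero>\<^bsub>R\<^esub>"] Gsub[OF Gth[OF M.M.zero_closed]]
      by (simp add: N.act_zero_left T.act_zero_left)
    have Gmi: "(\<ominus>\<^bsub>N\<^esub> a, \<ominus>\<^bsub>T\<^esub> b) \<in> G" if "(a, b) \<in> G" for a b
      using Gsm[OF _ that, of "\<ominus>\<^bsub>R\<^esub> \<one>\<^bsub>R\<^esub>"] Gsub[OF that]
      by (simp add: N.act_minus_one T.act_minus_one)
    have dom: "x \<in> fst ` G" if x: "x \<in> carrier N" for x
    proof -
      define ev where "ev = term_val N n x"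
      define W where "W = {e :: ('r, 'w) mrb_term. term_wf \<Omega> R e}"
      define rep where "rep = inv_into W ev"
      define C where "C = ev ` W"
      have evN: "ev e \<in> carrier N" if "term_wf \<Omega> R e" for e
        using that by (induction e) (auto simp: ev_def x nop N.act_closed)
      have gf: "ev (rep y) = y" if "y \<in> C" for y
        using that by (simp add: rep_def C_def f_inv_into_f)
      have CW: "y \<in> C" if "e \<in> W" "ev e = y" for y e using that by (auto simp: C_def)
      have CE: "\<exists>e\<in>W. ev e = y" if "y \<in> C" for y using that by (auto simp: C_def)
      have GenW: "Gen \<in> W" by (simp add: W_def)
      have xC: "x \<in> C" by (rule CW[OF GenW]) (simp add: ev_def)
      have Csub: "C \<subseteq> carrier N" using evN by (auto simp: C_def W_def)
      have Cad: "y \<oplus>\<^bsub>N\<^esub> z \<in> C" if yC: "y \<in> C" "z \<in> C" for y z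
      proof -
        obtain e f where "e \<in> W" "f \<in> W" "ev e = y" "ev f = z" using CE yC by blast
        then show ?thesis by (intro CW[of "Add e f"]) (auto simp: W_def ev_def)
      qed
      have Csm: "r \<odot>\<^bsub>N\<^esub> y \<in> C" if yC: "r \<in> carrier R" "y \<in> C" for r y
      proof -
        obtain e where "e \<in> W" "ev e = y" using CE yC by blast
        then show ?thesis using yC by (intro CW[of "Act r e"]) (auto simp: W_def ev_def)
      qed
      have Cop: "n \<omega> y \<in> C" if yC: "\<omega> \<in> \<Omega>" "y \<in> C" for \<omega> y
      proof -
        obtain e where "e \<in> W" "ev e = y" using CE yC by blast
        then show ?thesis using yC by (intro CW[of "Op \<omega> e"]) (auto simp: W_def ev_def)
      qed
      have C0: "\<zero>\<^bsub>N\<^esub> \<in> C" using Csm[of "\<zero>\<^bsub>R\<^esub>" x] xC x by (simp add: N.act_zero_left)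
      have Cmi: "\<ominus>\<^bsub>N\<^esub> y \<in> C" if "y \<in> C" for y
        using Csm[of "\<ominus>\<^bsub>R\<^esub> \<one>\<^bsub>R\<^esub>" y] that Csub by (auto simp: N.act_minus_one)
      define D where "D = C \<inter> fst ` G"
      have clC: "mrb_closed \<Omega> R N n C"
        using Csub C0 Cad Csm Cop by (simp add: mrb_closed_def)
      have DE: "\<exists>b. y \<in> C \<and> (y, b) \<in> G" if "y \<in> D" for y using that by (auto simp: D_def)
      have DI: "a \<in> D" if "a \<in> C" "(a, b) \<in> G" for a b using that by (force simp: D_def)
      have clD: "mrb_closed \<Omega> R N n D"
        unfolding mrb_closed_def
      proof (intro conjI ballI)
        show "D \<subseteq> carrier N" using Csub by (auto simp: D_def)
        show "\<zero>\<^bsub>N\<^esub> \<in> D" by (rule DI[OF C0 G0])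
        show "y \<oplus>\<^bsub>N\<^esub> z \<in> D" if "y \<in> D" "z \<in> D" for y z
          using DE[OF that(1)] DE[OF that(2)] Cad Gad DI by meson
        show "r \<odot>\<^bsub>N\<^esub> y \<in> D" if "r \<in> carrier R" "y \<in> D" for r y
          using DE[OF that(2)] that(1) Csm Gsm DI by meson
        show "n \<omega> y \<in> D" if "\<omega> \<in> \<Omega>" "y \<in> D" for \<omega> y
          using DE[OF that(2)] that(1) Cop Gop DI by meson
      qed
      have DC: "D \<subseteq> C" by (auto simp: D_def)
      define q where "q a = (THE b. (a, b) \<in> G)" for a
      have q: "q a = b" if "(a, b) \<in> G" for a b
        unfolding q_def using that Gsv by blast
      have qG: "(a, q a) \<in> G" if "a \<in> D" for a
        using that q by (auto simp: D_def)
      let ?o = "\<lambda>\<omega> a. rep (n \<omega> (ev a))"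
      let ?M = "transport rep ev D N" let ?N = "transport rep ev C N"
      have mM: "mrb_module K \<Omega> \<Lambda> R P ?M ?o"
        by (rule mrb_module_transport[OF N clD _ alg]) (use gf DC in auto)
      have mN: "mrb_module K \<Omega> \<Lambda> R P ?N ?o"
        by (rule mrb_module_transport[OF N clC _ alg]) (use gf in auto)
      have i: "id \<in> mrb_mono \<Omega> R ?M ?o ?N ?o"
        using DC by (auto simp: mrb_mono_def mrb_hom_def transport_def)
      have Dad: "\<And>y z. y \<in> D \<Longrightarrow> z \<in> D \<Longrightarrow> y \<oplus>\<^bsub>N\<^esub> z \<in> D"
        and Dsm: "\<And>r y. r \<in> carrier R \<Longrightarrow> y \<in> D \<Longrightarrow> r \<odot>\<^bsub>N\<^esub> y \<in> D"
        and Dop: "\<And>\<omega> y. \<omega> \<in> \<Omega> \<Longrightarrow> y \<in> D \<Longrightarrow> n \<omega> y \<in> D"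
        using clD by (auto simp: mrb_closed_def)
      have gfD: "ev (rep y) = y" if "y \<in> D" for y using that DC gf by auto
      have h: "(\<lambda>a. q (ev a)) \<in> mrb_hom \<Omega> R ?M ?o T t"
        unfolding mrb_hom_def
      proof (intro CollectI conjI ballI Pi_I)
        show "q (ev y) \<in> carrier T" if "y \<in> carrier ?M" for y
          using that Gsub[OF qG] by (auto simp: transport_def gfD)
        show "q (ev (y \<oplus>\<^bsub>?M\<^esub> z)) = q (ev y) \<oplus>\<^bsub>T\<^esub> q (ev z)"
          if "y \<in> carrier ?M" "z \<in> carrier ?M" for y z
          using that by (auto simp: transport_def gfD Dad intro!: q Gad qG)
        show "q (ev (r \<odot>\<^bsub>?M\<^esub> y)) = r \<odot>\<^bsub>T\<^esub> q (ev y)"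
          if "r \<in> carrier R" "y \<in> carrier ?M" for r y
          using that by (auto simp: transport_def gfD Dsm intro!: q Gsm qG)
        show "q (ev (rep (n \<omega> (ev y)))) = t \<omega> (q (ev y))"
          if "\<omega> \<in> \<Omega>" "y \<in> carrier ?M" for \<omega> y
          using that by (auto simp: transport_def gfD Dop intro!: q Gop qG)
      qed
      obtain \<psi> where ps: "\<psi> \<in> mrb_hom \<Omega> R ?N ?o T t"
        and pse: "\<And>y. y \<in> carrier ?M \<Longrightarrow> q (ev y) = \<psi> (id y)"
        using inj mM mN i h unfolding mrb_injective_def by meson
      define p where "p y = \<psi> (rep y)" for y
      have pT: "p y \<in> carrier T" if "y \<in> C" for y
        using that ps by (auto simp: mrb_hom_def transport_def p_def)
      have pad: "p (y \<oplus>\<^bsub>N\<^esub> z) = p y \<oplus>\<^bsub>T\<^esub> p z" if "y \<in> C" "z \<in> C" for y z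
        using that ps by (auto simp: mrb_hom_def transport_def p_def gf)
      have psm: "p (r \<odot>\<^bsub>N\<^esub> y) = r \<odot>\<^bsub>T\<^esub> p y" if "r \<in> carrier R" "y \<in> C" for r y
        using that ps by (auto simp: mrb_hom_def transport_def p_def gf)
      have pop: "p (n \<omega> y) = t \<omega> (p y)" if "\<omega> \<in> \<Omega>" "y \<in> C" for \<omega> y
        using that ps by (auto simp: mrb_hom_def transport_def p_def gf)
      have pG: "p y = b" if "y \<in> C" "(y, b) \<in> G" for y b
      proof -
        have "y \<in> D" by (rule DI[OF that])
        then have "q (ev (rep y)) = p y" using pse[of "rep y"] by (auto simp: transport_def p_def)
        then show ?thesis using gfD[OF \<open>y \<in> D\<close>] q[OF that(2)] by simp
      qed
      have p0: "p \<zero>\<^bsub>N\<^esub> = \<zero>\<^bsub>T\<^esub>" by (rule pG[OF C0 G0])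
      define H where "H = {(a \<oplus>\<^bsub>N\<^esub> c, b \<oplus>\<^bsub>T\<^esub> p c) | a b c. (a, b) \<in> G \<and> c \<in> C}"
      have HI: "(a \<oplus>\<^bsub>N\<^esub> c, b \<oplus>\<^bsub>T\<^esub> p c) \<in> H" if "(a, b) \<in> G" "c \<in> C" for a b c
        using that by (auto simp: H_def)
      have HI': "z \<in> H" if "(a, b) \<in> G" "c \<in> C" "z = (a \<oplus>\<^bsub>N\<^esub> c, b \<oplus>\<^bsub>T\<^esub> p c)" for a b c z
        using that by (auto simp: H_def)
      have HE: "\<exists>a b c. (a, b) \<in> G \<and> c \<in> C \<and> u = a \<oplus>\<^bsub>N\<^esub> c \<and> v = b \<oplus>\<^bsub>T\<^esub> p c"
        if "(u, v) \<in> H" for u v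
        using that by (auto simp: H_def)
      have CN: "\<And>c. c \<in> C \<Longrightarrow> c \<in> carrier N" using Csub by auto
      have GN: "\<And>a b. (a, b) \<in> G \<Longrightarrow> a \<in> carrier N"
        and GT: "\<And>a b. (a, b) \<in> G \<Longrightarrow> b \<in> carrier T" using Gsub by auto
      have GH: "G \<subseteq> H"
        using HI[OF _ C0] by (auto simp: p0) (metis GN GT N.M.r_zero T.M.r_zero)
      have "graph H"
        unfolding graph_def
      proof (intro conjI allI ballI impI)
        show "H \<subseteq> carrier N \<times> carrier T"
          by (auto simp: H_def GN GT CN pT)
        show "(\<theta> y, \<phi> y) \<in> H" if "y \<in> carrier M" for y using Gth[OF that] GH by auto
        fix u v u' v'
        assume uv: "(u, v) \<in> H" and uv': "(u', v') \<in> H"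
        obtain a b c where 1: "(a, b) \<in> G" "c \<in> C" "u = a \<oplus>\<^bsub>N\<^esub> c" "v = b \<oplus>\<^bsub>T\<^esub> p c"
          using HE[OF uv] by blast
        obtain a' b' c' where 2: "(a', b') \<in> G" "c' \<in> C" "u' = a' \<oplus>\<^bsub>N\<^esub> c'" "v' = b' \<oplus>\<^bsub>T\<^esub> p c'"
          using HE[OF uv'] by blast
        show "(u \<oplus>\<^bsub>N\<^esub> u', v \<oplus>\<^bsub>T\<^esub> v') \<in> H"
          by (rule HI'[OF Gad[OF 1(1) 2(1)] Cad[OF 1(2) 2(2)]])
            (use 1 2 in \<open>simp add: pad CN pT GN GT N.M.a_ac T.M.a_ac\<close>)
      next
        fix r u v assume r: "r \<in> carrier R" and uv: "(u, v) \<in> H"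
        obtain a b c where 1: "(a, b) \<in> G" "c \<in> C" "u = a \<oplus>\<^bsub>N\<^esub> c" "v = b \<oplus>\<^bsub>T\<^esub> p c"
          using HE[OF uv] by blast
        show "(r \<odot>\<^bsub>N\<^esub> u, r \<odot>\<^bsub>T\<^esub> v) \<in> H"
          by (rule HI'[OF Gsm[OF r 1(1)] Csm[OF r 1(2)]])
            (use 1 r GN[OF 1(1)] GT[OF 1(1)] in \<open>simp add: psm CN pT N.act_r_distr T.act_r_distr\<close>)
      next
        fix w u v assume w: "w \<in> \<Omega>" and uv: "(u, v) \<in> H"
        obtain a b c where 1: "(a, b) \<in> G" "c \<in> C" "u = a \<oplus>\<^bsub>N\<^esub> c" "v = b \<oplus>\<^bsub>T\<^esub> p c"
          using HE[OF uv] by blast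
        show "(n w u, t w v) \<in> H"
          by (rule HI'[OF Gop[OF w 1(1)] Cop[OF w 1(2)]])
            (use 1 w GN[OF 1(1)] GT[OF 1(1)] in \<open>simp add: pop CN pT nopa topa\<close>)
      next
        fix u v v' assume uv: "(u, v) \<in> H" and uv': "(u, v') \<in> H"
        obtain a b c where 1: "(a, b) \<in> G" "c \<in> C" "u = a \<oplus>\<^bsub>N\<^esub> c" "v = b \<oplus>\<^bsub>T\<^esub> p c"
          using HE[OF uv] by blast
        obtain a' b' c' where 2: "(a', b') \<in> G" "c' \<in> C" "u = a' \<oplus>\<^bsub>N\<^esub> c'" "v' = b' \<oplus>\<^bsub>T\<^esub> p c'"
          using HE[OF uv'] by blast
        note car = GN[OF 1(1)] GN[OF 2(1)] GT[OF 1(1)] GT[OF 2(1)] CN[OF 1(2)] CN[OF 2(2)]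
          pT[OF 1(2)] pT[OF 2(2)]
        have e: "c \<oplus>\<^bsub>N\<^esub> \<ominus>\<^bsub>N\<^esub> c' = a' \<oplus>\<^bsub>N\<^esub> \<ominus>\<^bsub>N\<^esub> a"
        proof -
          have "c = \<ominus>\<^bsub>N\<^esub> a \<oplus>\<^bsub>N\<^esub> (a' \<oplus>\<^bsub>N\<^esub> c')" using 1(3) 2(3) car
            by (metis N.M.add.inv_closed N.M.add.m_assoc N.M.l_neg N.M.l_zero)
          then have "c \<oplus>\<^bsub>N\<^esub> \<ominus>\<^bsub>N\<^esub> c' = (\<ominus>\<^bsub>N\<^esub> a \<oplus>\<^bsub>N\<^esub> a') \<oplus>\<^bsub>N\<^esub> (c' \<oplus>\<^bsub>N\<^esub> \<ominus>\<^bsub>N\<^esub> c')"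
            using car by (simp add: N.M.a_assoc)
          also have "\<dots> = a' \<oplus>\<^bsub>N\<^esub> \<ominus>\<^bsub>N\<^esub> a" using car by (simp add: N.M.r_neg N.M.a_comm)
          finally show ?thesis .
        qed
        have pm: "p (\<ominus>\<^bsub>N\<^esub> c') = \<ominus>\<^bsub>T\<^esub> p c'"
          using psm[of "\<ominus>\<^bsub>R\<^esub> \<one>\<^bsub>R\<^esub>" c'] 2(2) car by (simp add: N.act_minus_one T.act_minus_one)
        have "p c \<oplus>\<^bsub>T\<^esub> \<ominus>\<^bsub>T\<^esub> p c' = p (c \<oplus>\<^bsub>N\<^esub> \<ominus>\<^bsub>N\<^esub> c')"
          using pad[OF 1(2) Cmi[OF 2(2)]] pm by simp
        also have "\<dots> = b' \<oplus>\<^bsub>T\<^esub> \<ominus>\<^bsub>T\<^esub> b"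
          by (rule pG[OF Cad[OF 1(2) Cmi[OF 2(2)]]]) (use Gad[OF 2(1) Gmi[OF 1(1)]] e in simp)
        finally have e2: "p c \<oplus>\<^bsub>T\<^esub> \<ominus>\<^bsub>T\<^esub> p c' = b' \<oplus>\<^bsub>T\<^esub> \<ominus>\<^bsub>T\<^esub> b" .
        have "b \<oplus>\<^bsub>T\<^esub> p c = b \<oplus>\<^bsub>T\<^esub> ((p c \<oplus>\<^bsub>T\<^esub> \<ominus>\<^bsub>T\<^esub> p c') \<oplus>\<^bsub>T\<^esub> p c')"
          using car by (simp add: T.M.a_assoc T.M.l_neg)
        also have "\<dots> = b' \<oplus>\<^bsub>T\<^esub> (b \<oplus>\<^bsub>T\<^esub> \<ominus>\<^bsub>T\<^esub> b) \<oplus>\<^bsub>T\<^esub> p c'"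
          using car unfolding e2 by (simp add: T.M.a_ac)
        also have "\<dots> = b' \<oplus>\<^bsub>T\<^esub> p c'" using car by (simp add: T.M.r_neg)
        finally show "v = v'" using 1 2 by simp
      qed
      then have "H = G" using max GH by blast
      moreover have "(x, p x) \<in> H"
        by (rule HI'[OF G0 xC]) (use x pT[OF xC] in simp)
      ultimately show ?thesis by force
    qed
    define \<psi> where "\<psi> a = (THE b. (a, b) \<in> G)" for a
    have e: "\<psi> a = b" if "(a, b) \<in> G" for a b
      unfolding \<psi>_def using that Gsv by blast
    have i: "(a, \<psi> a) \<in> G" if "a \<in> carrier N" for a
      using dom[OF that] e by auto
    have "\<psi> \<in> mrb_hom \<Omega> R N n T t"
      unfolding mrb_hom_def
      by (intro CollectI conjI ballI Pi_I e Gad Gsm Gop i conjunct2[OF Gsub[OF i]])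
    moreover have "\<forall>x\<in>carrier M. \<phi> x = \<psi> (\<theta> x)" using e[OF Gth] by simp
    ultimately show ?thesis by blast
  qed
  then show ?thesis using T unfolding mrb_injective_def by blast
qed

end

theory Submission
  imports Defs
begin

text \<open>
  A left module over a multiple Rota-Baxter algebra is the same thing as a left module over a ring
  \<open>A\<close>, namely the ring generated by \<open>R\<close> and symbols for the operators, subject to linearity and to
  the Rota-Baxter relations.  The theorem is therefore an instance of the classical embedding of an
  \<open>A\<close>-module \<open>M\<close> into an injective \<open>A\<close>-module, which proceeds through the divisible group \<open>\<rat>/\<int>\<close>:
  for every set \<open>X\<close> the \<open>A\<close>-module \<open>Hom(A, (\<rat>/\<int>)\<^sup>X)\<close> of additive maps is injective, because
  \<open>A\<close>-linear maps \<open>N \<rightarrow> Hom(A, (\<rat>/\<int>)\<^sup>X)\<close> correspond to families of additive maps \<open>N \<rightarrow> \<rat>/\<int>\<close>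
  indexed by \<open>X\<close>, and these extend from submodules; and \<open>M\<close> embeds into this module as soon as \<open>X\<close>
  contains all additive maps \<open>M \<rightarrow> \<rat>/\<int>\<close>, because these separate the points of \<open>M\<close>.

  The ring \<open>A\<close> is replaced by terms: a term in the generator \<open>Gen\<close> denotes an element of \<open>A\<close>, every
  element is denoted by a term, and right multiplication by \<open>g\<close> is the substitution of \<open>g\<close> for the
  generator.  An element of \<open>Hom(A, (\<rat>/\<int>)\<^sup>X)\<close> is a function \<open>F\<close> of a term and an index that is
  additive in the term and constant on the classes of the congruence \<open>\<approx>\<close> generated by the module
  laws; \<open>r \<in> R\<close> acts on it by \<open>(r F)(e) = F(e[r Gen])\<close>, an operator by
  \<open>(\<omega> F)(e) = F(e[\<omega> Gen])\<close>.  The Rota-Baxter identity and the other laws that compare two operators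
  then hold in this module because they are instances of defining relations of \<open>\<approx>\<close> at the generator,
  carried over by substitution (\<open>shift_cong\<close>, \<open>shift_shift\<close>).

  The group \<open>\<rat>/\<int>\<close> is represented by the rationals in \<open>[0, 1)\<close>, with \<open>frac (u + v)\<close> as the sum.
  Two facts about it carry the proof: \<open>character_extends_along_injection\<close> gives
  the injectivity (\<open>coind_injective\<close>), \<open>character_separates\<close> gives the embedding
  (\<open>embedding_into_coind\<close>).  In both cases the homomorphism into the coinduced module comes from
  \<open>character_hom_in_mrb_hom\<close>, which is the correspondence above.
\<close>

section \<open>Additive maps into the rationals modulo one\<close>

text \<open>An additive map to \<open>\<rat>/\<int>\<close>, the latter represented by \<open>[0, 1)\<close>; the equation itself confines the
  values to this interval (\<open>is_character_frac\<close>).\<close>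

definition is_character :: "('a, 'c) ring_scheme \<Rightarrow> ('a \<Rightarrow> rat) \<Rightarrow> bool" where
  "is_character G \<chi> \<longleftrightarrow>
     (\<forall>x\<in>carrier G. \<forall>y\<in>carrier G. \<chi> (x \<oplus>\<^bsub>G\<^esub> y) = frac (\<chi> x + \<chi> y))"

text \<open>The graph of an additive map into \<open>\<rat>/\<int>\<close> defined on a subgroup, pulled back to
  \<open>G \<times> \<rat>\<close>: a subgroup of \<open>G \<times> \<rat>\<close> whose intersection with \<open>0 \<times> \<rat>\<close> is \<open>\<int>\<close>.  Working with
  all rational representatives of a value makes these graphs honest subgroups, so that no reduction
  modulo one occurs in the extension argument.\<close>

definition partial_character :: "('a, 'c) ring_scheme \<Rightarrow> ('a \<times> rat) set \<Rightarrow> bool" where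
  "partial_character G S \<longleftrightarrow>
     S \<subseteq> carrier G \<times> UNIV \<and> (\<zero>\<^bsub>G\<^esub>, 1) \<in> S \<and>
     (\<forall>a u b v. (a, u) \<in> S \<longrightarrow> (b, v) \<in> S \<longrightarrow> (a \<ominus>\<^bsub>G\<^esub> b, u - v) \<in> S) \<and>
     (\<forall>v. (\<zero>\<^bsub>G\<^esub>, v) \<in> S \<longrightarrow> v \<in> \<int>)"

lemma frac_cong: "(x :: rat) - y \<in> \<int> \<Longrightarrow> frac x = frac y"
  by (metis diff_add_cancel frac_add_int_left)

context abelian_group
begin

lemma add_int_pow_0 [simp]: "[(0::int)] \<cdot> a = \<zero>"
  by (simp add: add_pow_def)

lemma partial_character_closed:
  assumes S: "partial_character G S"
  shows "(\<zero>, 0) \<in> S"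
    and "(a, u) \<in> S \<Longrightarrow> a \<in> carrier G"
    and "(a, u) \<in> S \<Longrightarrow> (b, v) \<in> S \<Longrightarrow> (a \<ominus> b, u - v) \<in> S"
    and "(a, u) \<in> S \<Longrightarrow> (b, v) \<in> S \<Longrightarrow> (a \<oplus> b, u + v) \<in> S"
    and "(\<zero>, v) \<in> S \<Longrightarrow> v \<in> \<int>"
    and "(a, u) \<in> S \<Longrightarrow> ([(k::int)] \<cdot> a, of_int k * u) \<in> S"
proof -
  show diff: "(a \<ominus> b, u - v) \<in> S" if "(a, u) \<in> S" "(b, v) \<in> S" for a u b v
    using S that by (simp add: partial_character_def)
  show car: "a \<in> carrier G" if "(a, u) \<in> S" for a u
    using S that by (auto simp: partial_character_def)
  have one: "(\<zero>, 1) \<in> S" using S by (simp add: partial_character_def)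
  show zero: "(\<zero>, 0) \<in> S" using diff[OF one one] by (simp add: a_minus_def r_neg)
  have neg: "(\<ominus> a, - u) \<in> S" if "(a, u) \<in> S" for a u
    using diff[OF zero that] car[OF that] by (simp add: a_minus_def)
  show add: "(a \<oplus> b, u + v) \<in> S" if "(a, u) \<in> S" "(b, v) \<in> S" for a u b v
    using diff[OF that(1) neg[OF that(2)]] car[OF that(1)] car[OF that(2)]
    by (simp add: a_minus_def)
  show "(\<zero>, v) \<in> S \<Longrightarrow> v \<in> \<int>" using S by (simp add: partial_character_def)
  show "([(k::int)] \<cdot> a, of_int k * u) \<in> S" if au: "(a, u) \<in> S"
  proof (induction k rule: int_induct[where k = 0])
    case base
    show ?case using zero by simp
  next
    case (step1 i)
    then show ?case using add[OF step1(2) au] car[OF au]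
      by (simp add: add.int_pow_mult a_comm algebra_simps)
  next
    case (step2 i)
    then show ?case using diff[OF step2(2) au] car[OF au]
      by (simp add: add.int_pow_diff a_minus_def algebra_simps)
  qed
qed

lemma partial_character_single_valued:
  assumes S: "partial_character G S" and "(a, u) \<in> S" "(a, v) \<in> S"
  shows "frac u = frac v"
  using partial_character_closed(3)[OF S assms(2,3)] partial_character_closed(5)[OF S, of "u - v"]
    partial_character_closed(2)[OF S assms(2)]
  by (intro frac_cong) (simp add: a_minus_def r_neg)

text \<open>Divisibility of \<open>\<rat>\<close> provides a value \<open>p\<close> at a new element \<open>x\<close>.  If \<open>n\<close> is the
  least positive integer with \<open>n x\<close> in the domain, with value \<open>w\<close>, then \<open>p = w / n\<close> is compatible
  with the old values; if there is no such \<open>n\<close>, every \<open>p\<close> is compatible.  That \<open>p\<close> can be chosen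
  not to be an integer is what makes \<open>\<rat>/\<int>\<close> a cogenerator.\<close>

lemma partial_character_new_value:
  assumes S: "partial_character G S" and x: "x \<in> carrier G" and nd: "x \<notin> fst ` S"
  obtains p where "p \<notin> \<int>" and "\<And>k v. ([(k::int)] \<cdot> x, v) \<in> S \<Longrightarrow> v - of_int k * p \<in> \<int>"
proof (cases "\<exists>n>0. \<exists>v. ([(int n)] \<cdot> x, v) \<in> S")
  case True
  define n where "n = (LEAST n. n > 0 \<and> (\<exists>v. ([(int n)] \<cdot> x, v) \<in> S))"
  have n: "n > 0 \<and> (\<exists>v. ([(int n)] \<cdot> x, v) \<in> S)"
    unfolding n_def using True by (rule LeastI_ex)
  then obtain w where w: "([(int n)] \<cdot> x, w) \<in> S" by blast
  have min: "n \<le> i" if "i > 0" "([(int i)] \<cdot> x, v) \<in> S" for i v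
    unfolding n_def using that by (intro Least_le) blast
  \<comment> \<open>Otherwise \<open>x\<close> itself would lie in the domain.\<close>
  have "n \<noteq> 1" using w nd x by (metis add.int_pow_1 fst_conv image_eqI of_nat_1)
  then have n2: "n \<ge> 2" using n by simp
  \<comment> \<open>Changing \<open>w\<close> by an integer changes the value at \<open>n x\<close> by zero in \<open>\<rat>/\<int>\<close>.\<close>
  have compatible: "v - of_int k * (w' / of_nat n) \<in> \<int>"
    if kv: "([k] \<cdot> x, v) \<in> S" and w': "w' - w \<in> \<int>" for k v w'
  proof -
    define q where "q = k div int n"
    have qS: "([(k - q * int n)] \<cdot> x, v - of_int q * w) \<in> S"
      using partial_character_closed(3)[OF S kv partial_character_closed(6)[OF S w, of q]] x
      by (simp add: add.int_pow_diff add.int_pow_pow a_minus_def mult.commute)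
    have r: "k - q * int n = int (nat (k mod int n))"
      unfolding q_def using n by (simp add: minus_div_mult_eq_mod)
    \<comment> \<open>The remainder is a smaller multiple of \<open>x\<close> in the domain, so it vanishes by minimality.\<close>
    have "nat (k mod int n) < n" using n by (simp add: nat_less_iff)
    then have "nat (k mod int n) = 0"
      using min[of "nat (k mod int n)" "v - of_int q * w"] qS unfolding r
      by (metis leD not_gr_zero)
    with r have k: "k = q * int n" by simp
    then have "v - of_int q * w \<in> \<int>" using qS partial_character_closed(5)[OF S] by simp
    moreover have "v - of_int k * (w' / of_nat n) = (v - of_int q * w) - of_int q * (w' - w)"
      using k n by (simp add: field_simps)
    ultimately show ?thesis using w' by (simp only: Ints_diff Ints_mult Ints_of_int)
  qed
  \<comment> \<open>The values \<open>w / n\<close> and \<open>(w + 1) / n\<close> differ by \<open>1 / n\<close>, hence are not both integers.\<close>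
  have "w / of_nat n \<notin> \<int> \<or> (w + 1) / of_nat n \<notin> \<int>"
  proof (rule ccontr)
    assume "\<not> ?thesis"
    then have "(w + 1) / of_nat n - w / of_nat n \<in> \<int>" by (intro Ints_diff) auto
    moreover have "(w + 1) / of_nat n - w / of_nat n = 1 / of_nat n"
      by (simp add: add_divide_distrib)
    ultimately have i: "1 / (of_nat n :: rat) \<in> \<int>" by simp
    have "frac (1 / (of_nat n :: rat)) = 1 / of_nat n" using n2 by (intro frac_eq_id) simp
    then show False using i n by (simp flip: frac_eq_0_iff)
  qed
  moreover have "w - w \<in> \<int>" "w + 1 - w \<in> \<int>" by simp_all
  ultimately show ?thesis using that compatible by metis
next
  case False
  have "k = 0" if kv: "([k] \<cdot> x, v) \<in> S" for k :: int and v
  proof (rule ccontr)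
    assume "k \<noteq> 0"
    have abs: "int (nat \<bar>k\<bar>) = k * sgn k" by (metis abs_ge_zero abs_sgn nat_0_le)
    have "([(int (nat \<bar>k\<bar>))] \<cdot> x, of_int (sgn k) * v) \<in> S"
      using partial_character_closed(6)[OF S kv, of "sgn k"] x
      unfolding abs by (simp add: add.int_pow_pow mult.commute)
    then show False using False \<open>k \<noteq> 0\<close> by (metis abs_le_zero_iff not_le zero_less_nat_eq)
  qed
  then have *: "v \<in> \<int> \<and> k = 0" if "([k] \<cdot> x, v) \<in> S" for k :: int and v
    using that partial_character_closed(5)[OF S] by (metis add_int_pow_0)
  have "frac (1 / 2 :: rat) \<noteq> 0" by (subst frac_eq_id) simp_all
  then have "1 / 2 \<notin> (\<int> :: rat set)" by simp
  then show ?thesis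
  proof (rule that)
    show "v - of_int k * (1 / 2) \<in> \<int>" if "([k] \<cdot> x, v) \<in> S" for k :: int and v
      using *[OF that] by simp
  qed
qed

lemma partial_character_extend:
  assumes S: "partial_character G S" and x: "x \<in> carrier G" and nd: "x \<notin> fst ` S"
  obtains H p where "partial_character G H" "S \<subseteq> H" "(x, p) \<in> H" "p \<notin> \<int>"
proof -
  obtain p where p: "p \<notin> \<int>"
    and comp: "\<And>k v. ([(k::int)] \<cdot> x, v) \<in> S \<Longrightarrow> v - of_int k * p \<in> \<int>"
    using partial_character_new_value[OF assms] by blast
  define H where "H = {(a \<oplus> [k] \<cdot> x, u + of_int k * p) | a u (k::int). (a, u) \<in> S}"
  have HI: "z \<in> H" if "(a, u) \<in> S" "z = (a \<oplus> [(k::int)] \<cdot> x, u + of_int k * p)" for z a u k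
    using that by (auto simp: H_def)
  note car = partial_character_closed(2)[OF S]
  have "partial_character G H"
    unfolding partial_character_def
  proof (intro conjI allI impI)
    show "H \<subseteq> carrier G \<times> UNIV" using car x by (auto simp: H_def)
    have "(\<zero>, 1) \<in> S" using S by (simp add: partial_character_def)
    then show "(\<zero>, 1) \<in> H" by (rule HI[where k = 0]) simp
  next
    fix a u b v assume "(a, u) \<in> H" and "(b, v) \<in> H"
    then obtain a' u' k b' v' l where 1: "(a', u') \<in> S" "(b', v') \<in> S"
      "a = a' \<oplus> [(k::int)] \<cdot> x" "u = u' + of_int k * p" "b = b' \<oplus> [(l::int)] \<cdot> x" "v = v' + of_int l * p"
      unfolding H_def by blast
    show "(a \<ominus> b, u - v) \<in> H"
      by (rule HI[OF partial_character_closed(3)[OF S 1(1,2)], where k = "k - l"])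
        (use 1 car[OF 1(1)] car[OF 1(2)] x in
          \<open>simp add: a_minus_def add.int_pow_diff minus_add a_ac algebra_simps\<close>)
  next
    fix v assume "(\<zero>, v) \<in> H"
    then obtain a u k where 1: "(a, u) \<in> S" "\<zero> = a \<oplus> [(k::int)] \<cdot> x" "v = u + of_int k * p"
      unfolding H_def by blast
    have "a = [(- k)] \<cdot> x"
      using 1 car[OF 1(1)] x by (metis add.int_pow_closed add.int_pow_neg minus_equality)
    then show "v \<in> \<int>" using comp[of "- k" u] 1 by simp
  qed
  moreover have "S \<subseteq> H"
  proof
    fix s assume "s \<in> S"
    then show "s \<in> H"
      by (cases s) (use HI[where k = 0] car in force)
  qed
  moreover have "(x, p) \<in> H"
    by (rule HI[OF partial_character_closed(1)[OF S], where k = 1]) (use x in simp)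
  ultimately show ?thesis using p that by blast
qed

text \<open>A maximal extension, which exists by Zorn's lemma, is defined everywhere, since otherwise
  \<open>partial_character_extend\<close> would enlarge it.\<close>

lemma partial_character_extends_to_character:
  assumes S: "partial_character G S"
  obtains \<chi> where "is_character G \<chi>" "\<And>a u. (a, u) \<in> S \<Longrightarrow> \<chi> a = frac u"
proof -
  let ?A = "{H. partial_character G H \<and> S \<subseteq> H}"
  have "\<exists>H\<in>?A. \<forall>X\<in>?A. H \<subseteq> X \<longrightarrow> X = H"
  proof (rule subset_Zorn_nonempty)
    show "?A \<noteq> {}" using S by blast
    fix C assume ne: "C \<noteq> {}" and ch: "subset.chain ?A C"
    have pC: "\<And>H. H \<in> C \<Longrightarrow> partial_character G H" and SC: "\<And>H. H \<in> C \<Longrightarrow> S \<subseteq> H"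
      using ch by (auto simp: subset.chain_def)
    have two: "\<exists>H\<in>C. s \<in> H \<and> t \<in> H" if "s \<in> \<Union>C" "t \<in> \<Union>C" for s t
    proof -
      obtain G H where "G \<in> C" "s \<in> G" "H \<in> C" "t \<in> H" using \<open>s \<in> \<Union>C\<close> \<open>t \<in> \<Union>C\<close> by blast
      moreover have "G \<subseteq> H \<or> H \<subseteq> G" using ch calculation by (auto simp: subset_chain_def)
      ultimately show ?thesis by blast
    qed
    have "partial_character G (\<Union>C)"
      unfolding partial_character_def
    proof (intro conjI allI impI)
      show "\<Union>C \<subseteq> carrier G \<times> UNIV" using partial_character_closed(2)[OF pC] by auto
      show "(\<zero>, 1) \<in> \<Union>C" using ne pC by (auto simp: partial_character_def)
      show "(a \<ominus> b, u - v) \<in> \<Union>C" if "(a, u) \<in> \<Union>C" "(b, v) \<in> \<Union>C" for a u b v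
        using two[OF that] partial_character_closed(3)[OF pC] by blast
      show "v \<in> \<int>" if "(\<zero>, v) \<in> \<Union>C" for v
        using that partial_character_closed(5)[OF pC] by blast
    qed
    then show "\<Union>C \<in> ?A" using ne SC by blast
  qed
  then obtain H where HA: "H \<in> ?A" and maxA: "\<forall>X\<in>?A. H \<subseteq> X \<longrightarrow> X = H" by (rule bexE)
  have H: "partial_character G H" and SH: "S \<subseteq> H" using HA by simp_all
  have max: "X = H" if "partial_character G X" "H \<subseteq> X" for X
    using maxA SH that by simp
  have total: "\<exists>u. (x, u) \<in> H" if x: "x \<in> carrier G" for x
  proof (rule ccontr)
    assume no: "\<nexists>u. (x, u) \<in> H"
    then have "x \<notin> fst ` H" by force
    then obtain H' p where "partial_character G H'" "H \<subseteq> H'" "(x, p) \<in> H'"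
      using partial_character_extend[OF H x] by blast
    then show False using max no by blast
  qed
  define \<chi> where "\<chi> x = frac (SOME u. (x, u) \<in> H)" for x
  have \<chi>: "\<chi> x = frac u" if "(x, u) \<in> H" for x u
    unfolding \<chi>_def by (rule partial_character_single_valued[OF H someI[of _ u] that]) (rule that)
  have "is_character G \<chi>"
    unfolding is_character_def
  proof (intro ballI)
    fix x y assume "x \<in> carrier G" "y \<in> carrier G"
    then obtain u v where uv: "(x, u) \<in> H" "(y, v) \<in> H" using total by blast
    show "\<chi> (x \<oplus> y) = frac (\<chi> x + \<chi> y)"
      using \<chi>[OF partial_character_closed(4)[OF H uv]] \<chi>[OF uv(1)] \<chi>[OF uv(2)] by simp
  qed
  then show ?thesis using that \<chi> SH by blast
qed

text \<open>The zero map on the zero subgroup extends to the subgroup generated by \<open>x\<close> with a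
  non-integral, hence nonzero, value at \<open>x\<close>, and from there to the whole group.\<close>

lemma character_separates:
  assumes x: "x \<in> carrier G" "x \<noteq> \<zero>"
  obtains \<chi> where "is_character G \<chi>" "\<chi> x \<noteq> 0"
proof -
  let ?S = "{\<zero>} \<times> (\<int> :: rat set)"
  have S: "partial_character G ?S"
    by (auto simp: partial_character_def a_minus_def r_neg)
  have nd: "x \<notin> fst ` ?S" using x(2) by auto
  obtain H p where H: "partial_character G H" "(x, p) \<in> H" "p \<notin> \<int>"
    using partial_character_extend[OF S x(1) nd] by blast
  obtain \<chi> where \<chi>: "is_character G \<chi>" "\<And>a u. (a, u) \<in> H \<Longrightarrow> \<chi> a = frac u"
    using partial_character_extends_to_character[OF H(1)] by blast
  show ?thesis
    by (rule that[OF \<chi>(1)]) (use \<chi>(2)[OF H(2)] H(3) in simp)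
qed

end

text \<open>The value at \<open>x = x + 0\<close> is by definition a fractional part.\<close>

lemma is_character_frac:
  assumes "abelian_group G" "is_character G \<chi>" "x \<in> carrier G"
  shows "frac (\<chi> x) = \<chi> x"
proof -
  interpret abelian_group G by fact
  have "\<chi> (x \<oplus>\<^bsub>G\<^esub> \<zero>\<^bsub>G\<^esub>) = frac (\<chi> x + \<chi> \<zero>\<^bsub>G\<^esub>)"
    using assms(2,3) unfolding is_character_def by blast
  then show ?thesis using assms(3) by (metis frac_frac r_zero)
qed

lemma character_extends_along_injection:
  assumes G: "abelian_group G" and H: "abelian_group H"
    and \<theta>: "\<theta> \<in> carrier H \<rightarrow> carrier G" "inj_on \<theta> (carrier H)"
      "\<And>x y. x \<in> carrier H \<Longrightarrow> y \<in> carrier H \<Longrightarrow> \<theta> (x \<oplus>\<^bsub>H\<^esub> y) = \<theta> x \<oplus>\<^bsub>G\<^esub> \<theta> y"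
    and \<chi>: "is_character H \<chi>"
  obtains \<chi>' where "is_character G \<chi>'" "\<And>x. x \<in> carrier H \<Longrightarrow> \<chi>' (\<theta> x) = \<chi> x"
proof -
  interpret G: abelian_group G by fact
  interpret H: abelian_group H by fact
  have add: "\<chi> (x \<oplus>\<^bsub>H\<^esub> y) - (\<chi> x + \<chi> y) \<in> \<int>" if "x \<in> carrier H" "y \<in> carrier H" for x y
    using \<chi> that by (simp add: is_character_def frac_def)
  have zero: "\<theta> \<zero>\<^bsub>H\<^esub> = \<zero>\<^bsub>G\<^esub>"
    using \<theta>(3)[of "\<zero>\<^bsub>H\<^esub>" "\<zero>\<^bsub>H\<^esub>"] \<theta>(1) by (simp add: Pi_iff)
  have zero': "\<chi> \<zero>\<^bsub>H\<^esub> \<in> \<int>" using add[of "\<zero>\<^bsub>H\<^esub>" "\<zero>\<^bsub>H\<^esub>"] by simp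
  have neg: "\<theta> (\<ominus>\<^bsub>H\<^esub> x) = \<ominus>\<^bsub>G\<^esub> \<theta> x" if "x \<in> carrier H" for x
    using that \<theta>(1) \<theta>(3)[of "\<ominus>\<^bsub>H\<^esub> x" x] zero
    by (intro G.minus_equality[symmetric]) (auto simp: H.l_neg Pi_iff)
  \<comment> \<open>The graph of \<open>\<chi>\<close> transported to the image of \<open>\<theta>\<close>.\<close>
  define S where "S = {(\<theta> x, u) | x u. x \<in> carrier H \<and> u - \<chi> x \<in> \<int>}"
  have SI: "z \<in> S" if "x \<in> carrier H" "z = (\<theta> x, u)" "u - \<chi> x \<in> \<int>" for x u z
    using that by (auto simp: S_def)
  have "partial_character G S"
    unfolding partial_character_def
  proof (intro conjI allI impI)
    show "S \<subseteq> carrier G \<times> UNIV" using \<theta>(1) by (auto simp: S_def)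
    show "(\<zero>\<^bsub>G\<^esub>, 1) \<in> S"
      by (rule SI[of "\<zero>\<^bsub>H\<^esub>" _ 1]) (simp_all add: zero zero' Ints_diff)
  next
    fix a u b v assume "(a, u) \<in> S" "(b, v) \<in> S"
    then obtain x y where 1: "x \<in> carrier H" "y \<in> carrier H" "a = \<theta> x" "b = \<theta> y"
      "u - \<chi> x \<in> \<int>" "v - \<chi> y \<in> \<int>" unfolding S_def by blast
    have e: "x = (x \<ominus>\<^bsub>H\<^esub> y) \<oplus>\<^bsub>H\<^esub> y" using 1 by (simp add: a_minus_def H.a_assoc H.l_neg)
    have "\<chi> x - (\<chi> (x \<ominus>\<^bsub>H\<^esub> y) + \<chi> y) \<in> \<int>"
      using add[of "x \<ominus>\<^bsub>H\<^esub> y" y] e 1 by simp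
    with 1 have "(u - \<chi> x) - (v - \<chi> y) + (\<chi> x - (\<chi> (x \<ominus>\<^bsub>H\<^esub> y) + \<chi> y)) \<in> \<int>"
      by (intro Ints_add[OF Ints_diff])
    then have "u - v - \<chi> (x \<ominus>\<^bsub>H\<^esub> y) \<in> \<int>" by (simp add: algebra_simps)
    then show "(a \<ominus>\<^bsub>G\<^esub> b, u - v) \<in> S"
      by (intro SI[of "x \<ominus>\<^bsub>H\<^esub> y"]) (use 1 \<theta>(3) neg in \<open>auto simp: a_minus_def\<close>)
  next
    fix v assume "(\<zero>\<^bsub>G\<^esub>, v) \<in> S"
    then obtain x where x: "x \<in> carrier H" "\<theta> x = \<theta> \<zero>\<^bsub>H\<^esub>" "v - \<chi> x \<in> \<int>"
      by (auto simp: S_def zero)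
    then have "x = \<zero>\<^bsub>H\<^esub>" using \<theta>(2) by (simp add: inj_on_def)
    then show "v \<in> \<int>" using x(3) zero' by (metis Ints_add diff_add_cancel)
  qed
  then obtain \<chi>' where \<chi>': "is_character G \<chi>'" "\<And>a u. (a, u) \<in> S \<Longrightarrow> \<chi>' a = frac u"
    using G.partial_character_extends_to_character by blast
  show ?thesis
  proof (rule that[OF \<chi>'(1)])
    fix x assume x: "x \<in> carrier H"
    have "\<chi>' (\<theta> x) = frac (\<chi> x)" by (rule \<chi>'(2)[OF SI[OF x]]) auto
    then show "\<chi>' (\<theta> x) = \<chi> x" using is_character_frac[OF H \<chi> x] by simp
  qed
qed

section \<open>The ring of operators as terms modulo the module laws\<close>

text \<open>Substituting for the generator is composition of operators: the value of \<open>e[g]\<close> at \<open>y\<close> is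
  the value of \<open>e\<close> at the value of \<open>g\<close> at \<open>y\<close>.  It represents the multiplication of the ring
  \<open>A\<close>.\<close>

primrec term_subst :: "('r, 'w) mrb_term \<Rightarrow> ('r, 'w) mrb_term \<Rightarrow> ('r, 'w) mrb_term" where
  "term_subst Gen g = g"
| "term_subst (Add e f) g = Add (term_subst e g) (term_subst f g)"
| "term_subst (Act r e) g = Act r (term_subst e g)"
| "term_subst (Op w e) g = Op w (term_subst e g)"

lemma term_subst_Gen [simp]: "term_subst e Gen = e"
  by (induction e) simp_all

lemma term_subst_assoc: "term_subst (term_subst e g) h = term_subst e (term_subst g h)"
  by (induction e) simp_all

lemma term_wf_subst: "term_wf \<Omega> R e \<Longrightarrow> term_wf \<Omega> R g \<Longrightarrow> term_wf \<Omega> R (term_subst e g)"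
  by (induction e) simp_all

lemma term_val_subst: "term_val N n y (term_subst e g) = term_val N n (term_val N n y g) e"
  by (induction e) simp_all

locale mrb =
  fixes K :: "'k ring" and \<Omega> :: "'w set" and \<Lambda> :: "'w \<Rightarrow> 'k"
    and R :: "('k, 'r) module" and P :: "'w \<Rightarrow> 'r \<Rightarrow> 'r"
  assumes alg: "mrb_algebra K \<Omega> \<Lambda> R P"
begin

sublocale A: assoc_algebra K R using alg by (simp add: mrb_algebra_def)

lemma scalar_closed: "c \<in> carrier K \<Longrightarrow> c \<odot>\<^bsub>R\<^esub> \<one>\<^bsub>R\<^esub> \<in> carrier R"
  by simp

lemma weight_closed: "\<omega> \<in> \<Omega> \<Longrightarrow> \<Lambda> \<omega> \<in> carrier K"
  using alg by (auto simp: mrb_algebra_def)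

lemma P_closed: "\<omega> \<in> \<Omega> \<Longrightarrow> r \<in> carrier R \<Longrightarrow> P \<omega> r \<in> carrier R"
  using alg by (auto simp: mrb_algebra_def linear_operator_def)

abbreviation wf_term where "wf_term \<equiv> term_wf \<Omega> R"

text \<open>Commutativity and associativity of addition enter as the medial law, the form in which they
  make substitution additive in the substituted term.  The group structure itself is supplied by
  \<open>\<rat>/\<int>\<close>, in which the functions on terms take their values.\<close>

inductive term_cong :: "('r, 'w) mrb_term \<Rightarrow> ('r, 'w) mrb_term \<Rightarrow> bool" (infix "\<approx>" 50) where
  cong_refl: "wf_term e \<Longrightarrow> e \<approx> e"
| cong_sym: "e \<approx> f \<Longrightarrow> f \<approx> e"
| cong_trans: "e \<approx> f \<Longrightarrow> f \<approx> g \<Longrightarrow> e \<approx> g"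
| cong_Add: "e \<approx> e' \<Longrightarrow> f \<approx> f' \<Longrightarrow> Add e f \<approx> Add e' f'"
| cong_Act: "r \<in> carrier R \<Longrightarrow> e \<approx> e' \<Longrightarrow> Act r e \<approx> Act r e'"
| cong_Op: "\<omega> \<in> \<Omega> \<Longrightarrow> e \<approx> e' \<Longrightarrow> Op \<omega> e \<approx> Op \<omega> e'"
| medial: "wf_term a \<Longrightarrow> wf_term b \<Longrightarrow> wf_term c \<Longrightarrow> wf_term d \<Longrightarrow> Add (Add a b) (Add c d) \<approx> Add (Add a c) (Add b d)"
| Act_Add: "r \<in> carrier R \<Longrightarrow> wf_term e \<Longrightarrow> wf_term f \<Longrightarrow> Act r (Add e f) \<approx> Add (Act r e) (Act r f)"
| Act_plus: "r \<in> carrier R \<Longrightarrow> s \<in> carrier R \<Longrightarrow> wf_term e \<Longrightarrow> Act (r \<oplus>\<^bsub>R\<^esub> s) e \<approx> Add (Act r e) (Act s e)"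
| Act_times: "r \<in> carrier R \<Longrightarrow> s \<in> carrier R \<Longrightarrow> wf_term e \<Longrightarrow> Act (r \<otimes>\<^bsub>R\<^esub> s) e \<approx> Act r (Act s e)"
| Act_one: "wf_term e \<Longrightarrow> Act \<one>\<^bsub>R\<^esub> e \<approx> e"
| Op_Add: "\<omega> \<in> \<Omega> \<Longrightarrow> wf_term e \<Longrightarrow> wf_term f \<Longrightarrow> Op \<omega> (Add e f) \<approx> Add (Op \<omega> e) (Op \<omega> f)"
| Op_scalar: "\<omega> \<in> \<Omega> \<Longrightarrow> c \<in> carrier K \<Longrightarrow> wf_term e \<Longrightarrow>
    Op \<omega> (Act (c \<odot>\<^bsub>R\<^esub> \<one>\<^bsub>R\<^esub>) e) \<approx> Act (c \<odot>\<^bsub>R\<^esub> \<one>\<^bsub>R\<^esub>) (Op \<omega> e)"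
| Rota_Baxter: "\<alpha> \<in> \<Omega> \<Longrightarrow> \<beta> \<in> \<Omega> \<Longrightarrow> r \<in> carrier R \<Longrightarrow> wf_term e \<Longrightarrow>
    Act (P \<alpha> r) (Op \<beta> e) \<approx>
      Add (Add (Add (Op \<alpha> (Act r (Op \<beta> e))) (Op \<beta> (Act (P \<alpha> r) e)))
        (Act (\<Lambda> \<beta> \<odot>\<^bsub>R\<^esub> \<one>\<^bsub>R\<^esub>) (Op \<alpha> (Act r e)))) (Act (\<Lambda> \<alpha> \<odot>\<^bsub>R\<^esub> \<one>\<^bsub>R\<^esub>) (Op \<beta> (Act r e)))"

lemma term_cong_wf: "e \<approx> f \<Longrightarrow> wf_term e \<and> wf_term f"
  by (induction rule: term_cong.induct) (auto simp: scalar_closed weight_closed P_closed)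

lemma term_subst_cong_left: "e \<approx> f \<Longrightarrow> wf_term g \<Longrightarrow> term_subst e g \<approx> term_subst f g"
proof (induction rule: term_cong.induct)
  case (cong_sym e f)
  then show ?case by (blast intro: term_cong.cong_sym)
next
  case (cong_trans e f h)
  then show ?case by (blast intro: term_cong.cong_trans)
qed (simp_all add: term_cong.intros(1,4-) term_wf_subst)

lemma term_subst_cong_right: "g \<approx> h \<Longrightarrow> wf_term e \<Longrightarrow> term_subst e g \<approx> term_subst e h"
  by (induction e) (simp_all add: term_cong.intros(4-6))

text \<open>The left distributive law of the ring \<open>A\<close>: every term denotes an additive operator.\<close>

lemma term_subst_Add:
  assumes g: "wf_term g" and h: "wf_term h"
  shows "wf_term e \<Longrightarrow> term_subst e (Add g h) \<approx> Add (term_subst e g) (term_subst e h)"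
proof (induction e)
  case Gen
  then show ?case using g h by (simp add: cong_refl)
next
  case (Add e1 e2)
  then have "term_subst (Add e1 e2) (Add g h) \<approx>
      Add (Add (term_subst e1 g) (term_subst e1 h)) (Add (term_subst e2 g) (term_subst e2 h))"
    by (simp add: cong_Add)
  moreover have "\<dots> \<approx> Add (term_subst (Add e1 e2) g) (term_subst (Add e1 e2) h)"
    using Add.prems g h by (simp add: medial term_wf_subst)
  ultimately show ?case by (rule cong_trans)
next
  case (Act r e)
  then have "term_subst (Act r e) (Add g h) \<approx> Act r (Add (term_subst e g) (term_subst e h))"
    by (simp add: cong_Act)
  moreover have "\<dots> \<approx> Add (term_subst (Act r e) g) (term_subst (Act r e) h)"
    using Act.prems g h by (simp add: Act_Add term_wf_subst)
  ultimately show ?case by (rule cong_trans)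
next
  case (Op \<omega> e)
  then have "term_subst (Op \<omega> e) (Add g h) \<approx> Op \<omega> (Add (term_subst e g) (term_subst e h))"
    by (simp add: cong_Op)
  moreover have "\<dots> \<approx> Add (term_subst (Op \<omega> e) g) (term_subst (Op \<omega> e) h)"
    using Op.prems g h by (simp add: Op_Add term_wf_subst)
  ultimately show ?case by (rule cong_trans)
qed

end

section \<open>Evaluation of terms in a module\<close>

locale mrb_mod = mrb K \<Omega> \<Lambda> R P
  for K :: "'k ring" and \<Omega> :: "'w set" and \<Lambda> :: "'w \<Rightarrow> 'k"
    and R :: "('k, 'r) module" and P :: "'w \<Rightarrow> 'r \<Rightarrow> 'r" +
  fixes N :: "('r, 'n) module" and n :: "'w \<Rightarrow> 'n \<Rightarrow> 'n"
  assumes mod: "mrb_module K \<Omega> \<Lambda> R P N n"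
begin

sublocale N: left_module R N using mod by (simp add: mrb_module_def)

lemma op_closed: "\<omega> \<in> \<Omega> \<Longrightarrow> x \<in> carrier N \<Longrightarrow> n \<omega> x \<in> carrier N"
  and op_add: "\<omega> \<in> \<Omega> \<Longrightarrow> x \<in> carrier N \<Longrightarrow> y \<in> carrier N \<Longrightarrow>
        n \<omega> (x \<oplus>\<^bsub>N\<^esub> y) = n \<omega> x \<oplus>\<^bsub>N\<^esub> n \<omega> y"
  and op_scalar: "\<omega> \<in> \<Omega> \<Longrightarrow> c \<in> carrier K \<Longrightarrow> x \<in> carrier N \<Longrightarrow>
        n \<omega> ((c \<odot>\<^bsub>R\<^esub> \<one>\<^bsub>R\<^esub>) \<odot>\<^bsub>N\<^esub> x) = (c \<odot>\<^bsub>R\<^esub> \<one>\<^bsub>R\<^esub>) \<odot>\<^bsub>N\<^esub> n \<omega> x"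
  using mod by (auto simp: mrb_module_def linear_operator_def restrict_scalars_def)

lemma op_Rota_Baxter:
  "\<alpha> \<in> \<Omega> \<Longrightarrow> \<beta> \<in> \<Omega> \<Longrightarrow> r \<in> carrier R \<Longrightarrow> x \<in> carrier N \<Longrightarrow>
    P \<alpha> r \<odot>\<^bsub>N\<^esub> n \<beta> x =
      n \<alpha> (r \<odot>\<^bsub>N\<^esub> n \<beta> x) \<oplus>\<^bsub>N\<^esub> n \<beta> (P \<alpha> r \<odot>\<^bsub>N\<^esub> x)
        \<oplus>\<^bsub>N\<^esub> (\<Lambda> \<beta> \<odot>\<^bsub>R\<^esub> \<one>\<^bsub>R\<^esub>) \<odot>\<^bsub>N\<^esub> n \<alpha> (r \<odot>\<^bsub>N\<^esub> x)
        \<oplus>\<^bsub>N\<^esub> (\<Lambda> \<alpha> \<odot>\<^bsub>R\<^esub> \<one>\<^bsub>R\<^esub>) \<odot>\<^bsub>N\<^esub> n \<beta> (r \<odot>\<^bsub>N\<^esub> x)"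
  using mod by (simp add: mrb_module_def restrict_scalars_def)

lemma term_val_closed: "wf_term e \<Longrightarrow> y \<in> carrier N \<Longrightarrow> term_val N n y e \<in> carrier N"
  by (induction e) (simp_all add: N.act_closed op_closed)

text \<open>All defining relations of the congruence are laws of modules, so evaluation is well defined on
  classes.\<close>

lemma term_val_cong: "e \<approx> f \<Longrightarrow> y \<in> carrier N \<Longrightarrow> term_val N n y e = term_val N n y f"
proof (induction rule: term_cong.induct)
  case (medial a b c d)
  then show ?case by (simp add: term_val_closed N.M.a_ac)
next
  case (Rota_Baxter \<alpha> \<beta> r e)
  then show ?case by (simp add: term_val_closed op_Rota_Baxter)
qed (simp_all add: term_val_closed N.act_l_distr N.act_r_distr N.act_assoc N.act_one op_add op_scalar)

lemma term_val_add:
  assumes "x \<in> carrier N" "y \<in> carrier N"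
  shows "wf_term e \<Longrightarrow> term_val N n (x \<oplus>\<^bsub>N\<^esub> y) e = term_val N n x e \<oplus>\<^bsub>N\<^esub> term_val N n y e"
  by (induction e)
    (simp_all add: assms term_val_closed N.act_closed op_closed N.act_r_distr op_add N.M.a_ac)

lemma term_val_hom:
  assumes "\<theta> \<in> mrb_hom \<Omega> R N n N' n'" "x \<in> carrier N"
  shows "wf_term e \<Longrightarrow> \<theta> (term_val N n x e) = term_val N' n' (\<theta> x) e"
  using assms by (induction e) (simp_all add: mrb_hom_def term_val_closed)

end

section \<open>The coinduced module\<close>

context mrb
begin

text \<open>The action of the class of \<open>g\<close> on functions on \<open>A\<close>: precomposition with right
  multiplication by \<open>g\<close>.  The value zero outside the well-formed terms makes functions that agree
  on \<open>A\<close> equal.\<close>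

definition shift ::
    "('r, 'w) mrb_term \<Rightarrow> (('r, 'w) mrb_term \<Rightarrow> 'x \<Rightarrow> rat) \<Rightarrow> ('r, 'w) mrb_term \<Rightarrow> 'x \<Rightarrow> rat" where
  "shift g F = (\<lambda>e x. if wf_term e then F (term_subst e g) x else 0)"

text \<open>The module \<open>Hom(A, (\<rat>/\<int>)\<^sup>X)\<close>, where \<open>X\<close> is the type of the second argument.\<close>

definition coind :: "('r, ('r, 'w) mrb_term \<Rightarrow> 'x \<Rightarrow> rat) module" where
  "coind =
     \<lparr>carrier = {F. (\<forall>e x. frac (F e x) = F e x) \<and> (\<forall>e x. \<not> wf_term e \<longrightarrow> F e x = 0) \<and>
        (\<forall>e f x. wf_term e \<longrightarrow> wf_term f \<longrightarrow> F (Add e f) x = frac (F e x + F f x)) \<and>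
        (\<forall>e f. e \<approx> f \<longrightarrow> F e = F f)},
      mult = undefined, one = undefined, zero = (\<lambda>e x. 0),
      add = (\<lambda>F G e x. frac (F e x + G e x)), smult = (\<lambda>r. shift (Act r Gen))\<rparr>"

definition coind_op ::
    "'w \<Rightarrow> (('r, 'w) mrb_term \<Rightarrow> 'x \<Rightarrow> rat) \<Rightarrow> ('r, 'w) mrb_term \<Rightarrow> 'x \<Rightarrow> rat" where
  "coind_op \<omega> = shift (Op \<omega> Gen)"

lemma coind_simps [simp]:
  "\<zero>\<^bsub>coind\<^esub> = (\<lambda>e x. 0)"
  "F \<oplus>\<^bsub>coind\<^esub> G = (\<lambda>e x. frac (F e x + G e x))"
  "r \<odot>\<^bsub>coind\<^esub> F = shift (Act r Gen) F"
  by (simp_all add: coind_def)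

lemma coindI:
  assumes "\<And>e x. frac (F e x) = F e x" "\<And>e x. \<not> wf_term e \<Longrightarrow> F e x = 0"
    "\<And>e f x. wf_term e \<Longrightarrow> wf_term f \<Longrightarrow> F (Add e f) x = frac (F e x + F f x)"
    "\<And>e f x. e \<approx> f \<Longrightarrow> F e x = F f x"
  shows "F \<in> carrier coind"
  using assms by (auto simp: coind_def)

lemma coindD:
  assumes "F \<in> carrier coind"
  shows "frac (F e x) = F e x" "\<not> wf_term e \<Longrightarrow> F e x = 0"
    "wf_term e \<Longrightarrow> wf_term f \<Longrightarrow> F (Add e f) x = frac (F e x + F f x)"
    "e \<approx> f \<Longrightarrow> F e x = F f x"
  using assms by (auto simp: coind_def)

lemma shift_closed: "wf_term g \<Longrightarrow> F \<in> carrier coind \<Longrightarrow> shift g F \<in> carrier coind"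
  by (rule coindI)
    (auto simp: shift_def coindD(1,3) term_wf_subst dest: term_cong_wf
      intro: coindD(4) term_subst_cong_left)

lemma shift_add: "shift g (F \<oplus>\<^bsub>coind\<^esub> G) = shift g F \<oplus>\<^bsub>coind\<^esub> shift g G"
  by (auto simp: shift_def fun_eq_iff)

lemma shift_Add:
  "wf_term g \<Longrightarrow> wf_term h \<Longrightarrow> F \<in> carrier coind \<Longrightarrow> shift (Add g h) F = shift g F \<oplus>\<^bsub>coind\<^esub> shift h F"
  by (auto simp: shift_def fun_eq_iff coindD(4)[OF _ term_subst_Add] coindD(3) term_wf_subst)

text \<open>Associativity of \<open>A\<close>: it turns precomposition with right multiplications into a left
  action.\<close>

lemma shift_shift: "wf_term h \<Longrightarrow> shift h (shift g F) = shift (term_subst h g) F"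
  by (auto simp: shift_def fun_eq_iff term_wf_subst term_subst_assoc)

lemma shift_cong: "g \<approx> h \<Longrightarrow> F \<in> carrier coind \<Longrightarrow> shift g F = shift h F"
  by (auto simp: shift_def fun_eq_iff intro!: coindD(4) term_subst_cong_right)

lemma shift_Gen: "F \<in> carrier coind \<Longrightarrow> shift Gen F = F"
  by (auto simp: shift_def fun_eq_iff coindD(2))

lemma abelian_group_coind: "abelian_group (coind :: ('r, ('r, 'w) mrb_term \<Rightarrow> 'x \<Rightarrow> rat) module)"
    (is "abelian_group ?T")
proof (rule abelian_groupI, goal_cases)
  case (1 F G)
  show ?case
  proof (rule coindI, goal_cases)
    case (3 e f x)
    have "frac (frac (a + b) + frac (c + d)) = frac (frac (a + c) + frac (b + d))"
      for a b c d :: rat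
      by simp (simp add: ac_simps)
    then show ?case using 1 3 by (simp only: coind_simps coindD(3))
  next
    case (4 e f x)
    then show ?case using 1 coindD(4)[of F e f x] coindD(4)[of G e f x] by simp
  qed (use 1 in \<open>simp_all add: coindD(2)\<close>)
next
  case 2
  show ?case by (rule coindI) simp_all
next
  case (3 F G H)
  then show ?case by (simp add: add.assoc)
next
  case (4 F G)
  then show ?case by (simp add: add.commute)
next
  case (5 F)
  then show ?case by (simp add: coindD(1))
next
  case (6 F)
  have neg: "frac (- frac (u + v)) = frac (frac (- u) + frac (- v))" for u v :: rat
    by (simp only: frac_neg_frac frac_add_simps minus_add_distrib)
  have "(\<lambda>e x. frac (- F e x)) \<in> carrier ?T"
  proof (rule coindI, goal_cases)
    case (3 e f x)
    then show ?case using 6 neg by (simp add: coindD(3))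
  next
    case (4 e f x)
    then show ?case using 6 coindD(4)[of F e f x] by simp
  qed (use 6 in \<open>simp_all add: coindD(2)\<close>)
  then show ?case by (intro bexI[of _ "\<lambda>e x. frac (- F e x)"]) simp_all
qed

text \<open>Additivity in \<open>F\<close> holds pointwise.  Each of the other laws asserts that two terms in the
  generator act equally on \<open>F\<close>, and these terms are congruent by a defining relation.\<close>

lemma mrb_module_coind:
  "mrb_module K \<Omega> \<Lambda> R P (coind :: ('r, ('r, 'w) mrb_term \<Rightarrow> 'x \<Rightarrow> rat) module) coind_op"
    (is "mrb_module K \<Omega> \<Lambda> R P ?T _")
proof -
  have smult: "r \<odot>\<^bsub>?T\<^esub> F = shift (Act r Gen) F" for r F by simp
  have lm: "left_module R ?T"
  proof (intro left_module.intro left_module_axioms.intro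
      A.ring_axioms abelian_group_coind, goal_cases)
    case (1 a F)
    then show ?case by (simp add: shift_closed)
  next
    case (2 a b F)
    have "shift (Act (a \<oplus>\<^bsub>R\<^esub> b) Gen) F = shift (Add (Act a Gen) (Act b Gen)) F"
      using 2 by (intro shift_cong Act_plus) simp_all
    with 2 show ?case unfolding smult by (simp only: shift_Add term_wf.simps)
  next
    case (3 a F G)
    show ?case unfolding smult by (rule shift_add)
  next
    case (4 a b F)
    have "shift (Act (a \<otimes>\<^bsub>R\<^esub> b) Gen) F = shift (Act a (Act b Gen)) F"
      using 4 by (intro shift_cong Act_times) simp_all
    with 4 show ?case by (simp add: shift_shift)
  next
    case (5 F)
    have "shift (Act \<one>\<^bsub>R\<^esub> Gen) F = shift Gen F"
      using 5 by (intro shift_cong Act_one) simp_all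
    with 5 show ?case by (simp add: shift_Gen)
  qed
  have lin: "linear_operator K (restrict_scalars R ?T) (coind_op \<omega>)" if \<omega>: "\<omega> \<in> \<Omega>" for \<omega>
    unfolding linear_operator_def
  proof (intro conjI ballI Pi_I)
    fix F :: "('r, 'w) mrb_term \<Rightarrow> 'x \<Rightarrow> rat" assume "F \<in> carrier (restrict_scalars R ?T)"
    then have F: "F \<in> carrier ?T" by (simp add: restrict_scalars_def)
    show "coind_op \<omega> F \<in> carrier (restrict_scalars R ?T)"
      using F \<omega> by (simp add: restrict_scalars_def coind_op_def shift_closed)
    show "coind_op \<omega> (F \<oplus>\<^bsub>restrict_scalars R ?T\<^esub> G) =
        coind_op \<omega> F \<oplus>\<^bsub>restrict_scalars R ?T\<^esub> coind_op \<omega> G" for G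
      using shift_add by (simp add: restrict_scalars_def coind_op_def)
    fix c assume c: "c \<in> carrier K"
    have "shift (Op \<omega> (Act (c \<odot>\<^bsub>R\<^esub> \<one>\<^bsub>R\<^esub>) Gen)) F = shift (Act (c \<odot>\<^bsub>R\<^esub> \<one>\<^bsub>R\<^esub>) (Op \<omega> Gen)) F"
      using F c \<omega> by (intro shift_cong Op_scalar) simp_all
    then show "coind_op \<omega> (c \<odot>\<^bsub>restrict_scalars R ?T\<^esub> F) =
        c \<odot>\<^bsub>restrict_scalars R ?T\<^esub> coind_op \<omega> F"
      using c \<omega> by (simp add: restrict_scalars_def coind_op_def shift_shift)
  qed
  show ?thesis
    unfolding mrb_module_def
  proof (intro conjI ballI lm lin, assumption)
    fix \<alpha> \<beta> r F
    assume h: "\<alpha> \<in> \<Omega>" "\<beta> \<in> \<Omega>" "r \<in> carrier R" and F: "F \<in> carrier ?T"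
    let ?e1 = "Op \<alpha> (Act r (Op \<beta> Gen))" and ?e2 = "Op \<beta> (Act (P \<alpha> r) Gen)"
      and ?e3 = "Act (\<Lambda> \<beta> \<odot>\<^bsub>R\<^esub> \<one>\<^bsub>R\<^esub>) (Op \<alpha> (Act r Gen))"
      and ?e4 = "Act (\<Lambda> \<alpha> \<odot>\<^bsub>R\<^esub> \<one>\<^bsub>R\<^esub>) (Op \<beta> (Act r Gen))"
    have "shift (Act (P \<alpha> r) (Op \<beta> Gen)) F = shift (Add (Add (Add ?e1 ?e2) ?e3) ?e4) F"
      using h F by (intro shift_cong Rota_Baxter) simp_all
    also have "\<dots> = shift ?e1 F \<oplus>\<^bsub>?T\<^esub> shift ?e2 F \<oplus>\<^bsub>?T\<^esub> shift ?e3 F \<oplus>\<^bsub>?T\<^esub> shift ?e4 F"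
      using h F by (simp only: shift_Add term_wf.simps scalar_closed weight_closed P_closed simp_thms)
    finally show "P \<alpha> r \<odot>\<^bsub>?T\<^esub> coind_op \<beta> F =
        coind_op \<alpha> (r \<odot>\<^bsub>?T\<^esub> coind_op \<beta> F) \<oplus>\<^bsub>?T\<^esub> coind_op \<beta> (P \<alpha> r \<odot>\<^bsub>?T\<^esub> F)
          \<oplus>\<^bsub>?T\<^esub> \<Lambda> \<beta> \<odot>\<^bsub>restrict_scalars R ?T\<^esub> coind_op \<alpha> (r \<odot>\<^bsub>?T\<^esub> F)
          \<oplus>\<^bsub>?T\<^esub> \<Lambda> \<alpha> \<odot>\<^bsub>restrict_scalars R ?T\<^esub> coind_op \<beta> (r \<odot>\<^bsub>?T\<^esub> F)"
      using h by (simp add: restrict_scalars_def coind_op_def shift_shift scalar_closed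
        weight_closed P_closed)
  qed
qed

lemma term_val_coind:
  "wf_term e \<Longrightarrow> F \<in> carrier coind \<Longrightarrow> term_val coind coind_op F e = shift e F"
proof (induction e)
  case (Add e f)
  then show ?case by (simp only: term_val.simps term_wf.simps shift_Add)
qed (simp_all add: shift_Gen coind_op_def shift_shift)

text \<open>An element \<open>F\<close> is recovered from the values of its multiples at the generator, which denotes
  the unit of \<open>A\<close>.  Hence a homomorphism into the coinduced module is determined by the values of its
  images at the generator.\<close>

lemma eval_coind:
  "wf_term e \<Longrightarrow> F \<in> carrier coind \<Longrightarrow> term_val coind coind_op F e Gen = F e"
  by (simp add: term_val_coind) (simp add: shift_def)

end

section \<open>Homomorphisms into the coinduced module\<close>

context mrb_mod
begin

definition character_hom :: "('x \<Rightarrow> 'n \<Rightarrow> rat) \<Rightarrow> 'n \<Rightarrow> ('r, 'w) mrb_term \<Rightarrow> 'x \<Rightarrow> rat" where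
  "character_hom X y = (\<lambda>e x. if wf_term e then X x (term_val N n y e) else 0)"

text \<open>Acting on \<open>y\<close> by \<open>g\<close> before evaluating \<open>e\<close> is evaluating \<open>e[g]\<close> at \<open>y\<close>, which is how \<open>g\<close>
  acts on the coinduced module.  This is one direction of the adjunction between additive maps out
  of \<open>N\<close> and homomorphisms from \<open>N\<close> to the coinduced module.\<close>

lemma character_hom_in_mrb_hom:
  assumes X: "\<And>x. is_character N (X x)"
  shows "character_hom X \<in> mrb_hom \<Omega> R N n coind coind_op"
proof -
  have add: "X x (y \<oplus>\<^bsub>N\<^esub> z) = frac (X x y + X x z)" if "y \<in> carrier N" "z \<in> carrier N" for x y z
    using X that by (simp add: is_character_def)
  have frac: "frac (X x y) = X x y" if "y \<in> carrier N" for x y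
    by (rule is_character_frac[OF N.M.abelian_group_axioms X that])
  have shift: "character_hom X (term_val N n y g) = shift g (character_hom X y)" if "wf_term g" for g y
    using that by (auto simp: character_hom_def shift_def term_val_subst term_wf_subst fun_eq_iff)
  show ?thesis
    unfolding mrb_hom_def
  proof (intro CollectI conjI ballI Pi_I)
    fix y assume y: "y \<in> carrier N"
    show "character_hom X y \<in> carrier coind"
    proof (rule coindI, goal_cases)
      case (4 e f x)
      then show ?case using term_cong_wf[OF 4] term_val_cong[OF 4 y] by (simp add: character_hom_def)
    qed (use y in \<open>simp_all add: character_hom_def frac add term_val_closed\<close>)
    show "character_hom X (y \<oplus>\<^bsub>N\<^esub> z) = character_hom X y \<oplus>\<^bsub>coind\<^esub> character_hom X z"
      if "z \<in> carrier N" for z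
      using y that
      by (intro ext) (simp add: character_hom_def term_val_add add term_val_closed)
  next
    fix r y assume "r \<in> carrier R" "y \<in> carrier N"
    then show "character_hom X (r \<odot>\<^bsub>N\<^esub> y) = r \<odot>\<^bsub>coind\<^esub> character_hom X y"
      using shift[of "Act r Gen" y] by simp
  next
    fix \<omega> y assume "\<omega> \<in> \<Omega>" "y \<in> carrier N"
    then show "character_hom X (n \<omega> y) = coind_op \<omega> (character_hom X y)"
      using shift[of "Op \<omega> Gen" y] by (simp add: coind_op_def)
  qed
qed

text \<open>With the functions on \<open>N\<close> as indices, the family of all characters of \<open>N\<close> separates the
  points of \<open>N\<close> at the generator alone.\<close>

lemma embedding_into_coind:
  obtains \<iota> :: "'n \<Rightarrow> ('r, 'w) mrb_term \<Rightarrow> ('n \<Rightarrow> rat) \<Rightarrow> rat"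
  where "\<iota> \<in> mrb_mono \<Omega> R N n coind coind_op"
proof -
  \<comment> \<open>A function that is not a character contributes the zero character.\<close>
  define X where "X \<chi> = (if is_character N \<chi> then \<chi> else (\<lambda>_. 0))" for \<chi>
  have X: "is_character N (X \<chi>)" for \<chi> by (simp add: X_def is_character_def)
  note hom = character_hom_in_mrb_hom[of X, OF X]
  have "inj_on (character_hom X) (carrier N)"
  proof (rule inj_onI, rule ccontr)
    fix y z assume y: "y \<in> carrier N" and z: "z \<in> carrier N"
      and eq: "character_hom X y = character_hom X z" and ne: "y \<noteq> z"
    have yz: "y = (y \<ominus>\<^bsub>N\<^esub> z) \<oplus>\<^bsub>N\<^esub> z" using y z by (simp add: a_minus_def N.M.a_assoc N.M.l_neg)
    have d: "y \<ominus>\<^bsub>N\<^esub> z \<in> carrier N" "y \<ominus>\<^bsub>N\<^esub> z \<noteq> \<zero>\<^bsub>N\<^esub>"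
      using y z ne yz by auto
    obtain \<chi> where \<chi>: "is_character N \<chi>" "\<chi> (y \<ominus>\<^bsub>N\<^esub> z) \<noteq> 0"
      using N.M.character_separates[OF d] by blast
    have "character_hom X y Gen \<chi> = character_hom X z Gen \<chi>" using eq by simp
    then have "\<chi> y = \<chi> z" using \<chi>(1) by (simp add: character_hom_def X_def)
    moreover have "\<chi> y = frac (\<chi> (y \<ominus>\<^bsub>N\<^esub> z) + \<chi> z)"
      using \<chi>(1) yz d(1) z unfolding is_character_def by metis
    ultimately have "\<chi> (y \<ominus>\<^bsub>N\<^esub> z) \<in> \<int>"
      by (metis add_diff_cancel_right' frac_unique_iff)
    moreover have "frac (\<chi> (y \<ominus>\<^bsub>N\<^esub> z)) = \<chi> (y \<ominus>\<^bsub>N\<^esub> z)"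
      by (rule is_character_frac[OF N.M.abelian_group_axioms \<chi>(1) d(1)])
    ultimately show False using \<chi>(2) by (metis frac_eq_0_iff)
  qed
  then show ?thesis using hom by (intro that) (simp add: mrb_mono_def)
qed

end

text \<open>A homomorphism \<open>\<phi>\<close> into the coinduced module corresponds to the family of characters
  \<open>y \<mapsto> \<phi> y Gen x\<close>.  These extend along \<open>\<theta>\<close> one index at a time, and the extended family gives
  back a homomorphism, whose composition with \<open>\<theta>\<close> is \<open>\<phi>\<close> because the images under both have the
  same values at the generator (\<open>eval_coind\<close>).\<close>

lemma (in mrb) coind_injective:
  "mrb_injective TYPE('a) TYPE('b) K \<Omega> \<Lambda> R P
     (coind :: ('r, ('r, 'w) mrb_term \<Rightarrow> 'x \<Rightarrow> rat) module) coind_op"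
  unfolding mrb_injective_def
proof (intro conjI mrb_module_coind allI impI)
  fix M :: "('r, 'a) module" and m and N :: "('r, 'b) module" and n \<theta>
    and \<phi> :: "'a \<Rightarrow> ('r, 'w) mrb_term \<Rightarrow> 'x \<Rightarrow> rat"
  assume M: "mrb_module K \<Omega> \<Lambda> R P M m" and N: "mrb_module K \<Omega> \<Lambda> R P N n"
    and \<theta>: "\<theta> \<in> mrb_mono \<Omega> R M m N n" and \<phi>: "\<phi> \<in> mrb_hom \<Omega> R M m coind coind_op"
  interpret M: mrb_mod K \<Omega> \<Lambda> R P M m by unfold_locales (rule M)
  interpret N: mrb_mod K \<Omega> \<Lambda> R P N n by unfold_locales (rule N)
  have \<theta>h: "\<theta> \<in> mrb_hom \<Omega> R M m N n" and \<theta>i: "inj_on \<theta> (carrier M)"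
    using \<theta> by (auto simp: mrb_mono_def)
  have \<theta>c: "\<theta> \<in> carrier M \<rightarrow> carrier N"
    and \<theta>a: "\<And>y z. y \<in> carrier M \<Longrightarrow> z \<in> carrier M \<Longrightarrow> \<theta> (y \<oplus>\<^bsub>M\<^esub> z) = \<theta> y \<oplus>\<^bsub>N\<^esub> \<theta> z"
    using \<theta>h by (simp_all add: mrb_hom_def)
  have "\<exists>\<chi>. is_character N \<chi> \<and> (\<forall>y\<in>carrier M. \<chi> (\<theta> y) = \<phi> y Gen x)" for x
  proof -
    have "is_character M (\<lambda>y. \<phi> y Gen x)"
      using \<phi> by (simp add: is_character_def mrb_hom_def)
    from character_extends_along_injection[OF N.N.M.abelian_group_axioms
        M.N.M.abelian_group_axioms \<theta>c \<theta>i \<theta>a this]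
    show ?thesis by metis
  qed
  then obtain X where X: "\<And>x. is_character N (X x)"
    and X\<phi>: "\<And>x y. y \<in> carrier M \<Longrightarrow> X x (\<theta> y) = \<phi> y Gen x" by metis
  have "\<phi> y = N.character_hom X (\<theta> y)" if y: "y \<in> carrier M" for y
  proof (intro ext)
    fix e x
    have \<phi>y: "\<phi> y \<in> carrier coind" using \<phi> y by (auto simp: mrb_hom_def)
    show "\<phi> y e x = N.character_hom X (\<theta> y) e x"
    proof (cases "wf_term e")
      case True
      have "X x (term_val N n (\<theta> y) e) = X x (\<theta> (term_val M m y e))"
        by (simp add: M.term_val_hom[OF \<theta>h y True])
      also have "\<dots> = \<phi> (term_val M m y e) Gen x"
        by (rule X\<phi>[OF M.term_val_closed[OF True y]])
      also have "\<dots> = \<phi> y e x"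
        by (simp add: M.term_val_hom[OF \<phi> y True] eval_coind[OF True \<phi>y])
      finally show ?thesis using True by (simp add: N.character_hom_def)
    next
      case False
      then show ?thesis using coindD(2)[OF \<phi>y] by (simp add: N.character_hom_def)
    qed
  qed
  then show "\<exists>\<psi>\<in>mrb_hom \<Omega> R N n coind coind_op. \<forall>y\<in>carrier M. \<phi> y = \<psi> (\<theta> y)"
    by (intro bexI[of _ "N.character_hom X"] ballI N.character_hom_in_mrb_hom X)
qed

section \<open>Embedding into an injective module\<close>

theorem theorem3p10:
  fixes K :: "'k ring" and \<Omega> :: "'w set" and \<Lambda> :: "'w \<Rightarrow> 'k"
    and R :: "('k, 'r) module" and P :: "'w \<Rightarrow> 'r \<Rightarrow> 'r"
    and M :: "('r, 'm) module" and m :: "'w \<Rightarrow> 'm \<Rightarrow> 'm"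
  assumes "mrb_algebra K \<Omega> \<Lambda> R P"
    and "mrb_module K \<Omega> \<Lambda> R P M m"
  shows "\<exists>(T :: ('r, ('r, 'w) mrb_term \<Rightarrow> ('m \<Rightarrow> rat) \<Rightarrow> rat) module) t \<iota>.
    mrb_injective TYPE(('r, 'w) mrb_term) TYPE(('r, 'w) mrb_term) K \<Omega> \<Lambda> R P T t \<and>
    mrb_injective TYPE('a) TYPE('b) K \<Omega> \<Lambda> R P T t \<and>
    \<iota> \<in> mrb_mono \<Omega> R M m T t"
proof -
  interpret M: mrb_mod K \<Omega> \<Lambda> R P M m
    by unfold_locales (rule assms)+
  obtain \<iota> :: "'m \<Rightarrow> ('r, 'w) mrb_term \<Rightarrow> ('m \<Rightarrow> rat) \<Rightarrow> rat"
    where "\<iota> \<in> mrb_mono \<Omega> R M m M.coind M.coind_op"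
    by (rule M.embedding_into_coind)
  with M.coind_injective M.coind_injective show ?thesis by (intro exI conjI)
qed

end
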